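(* Let $A$ be a finite set and $\mathbf{B}=(B,\mathcal{F})$ a finite algebra with a cube term. Then each clonoid $C$ with source set $A$ and target algebra $\mathbf{B}$ is finitely related. Hence there are at most countably many clonoids with source set $A$ and target algebra $\mathbf{B}$.
   Context: $\mathbb{N}=\{1,2,\dots\}$ and $[k]=\{1,\dots,k\}$. An algebra $\mathbf{B}=(B,\mathcal{F})$ is a set $B$ with a (possibly empty, possibly infinite) set $\mathcal{F}$ of finitary operations on $B$; it is finite if $B$ is finite. Its term operations are the operations obtained from projections and $\mathcal{F}$ by composition. Minors: for $f\colon A^k\to B$, $\ell\in\mathbb{N}$ and $\sigma\colon[k]\to[\ell]$, the function $f^\sigma\colon A^\ell\to B$, $(x_1,\dots,x_\ell)\mapsto f(x_{\sigma(1)},\dots,x_{\sigma(k)})$ is a minor of $f$. Clonoids: for $C\subseteq\bigcup_{n\in\mathbb{N}}B^{A^n}$ let $C_k:=C\cap B^{A^k}$. $C$ is a clonoid with source set $A$ and target algebra $\mathbf{B}$ if $C$ is closed under taking minors and, for all $k\in\mathbb{N}$, $C_k$ is a subalgebra of $\mathbf{B}^{A^k}$ (i.e. closed under the pointwise operations of $\mathbf{B}$; the empty set is allowed). Cube terms: for $k\in\mathbb{N}$ let $X$ be the $k\times(2^k-1)$ matrix whose columns are the elements of $\{x,y\}^k\setminus\{\bar x\}$ (formal tuples in two variables $x,y$), where $\bar x=(x,\dots,x)$. A $k$-cube term of $\mathbf{B}$ is a $(2^k-1)$-ary term operation $c$ of $\mathbf{B}$ such that $c(X)=\bar x$ for all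 $x,y\in B$, where $c$ is applied to every row of $X$. A cube term is a $k$-cube term for some $k$. Finitely related: for $m$-ary relations $P\subseteq A^m$, $Q\subseteq B^m$, a function $f\colon A^k\to B$ is a polymorphism of $(P,Q)$ if $f$ applied componentwise to any $k$-tuple of elements of $P$ gives an element of $Q$. For a set $R$ of such pairs (arities may vary), $\mathrm{Pol}(R)$ is the set of all functions (of all arities $k\in\mathbb{N}$) that are polymorphisms of every pair in $R$. A clonoid $C$ is finitely related if $C=\mathrm{Pol}(R)$ for some finite set $R$ of pairs of finitary relations on $A$ and $B$. *)

theory Defs
  imports Main "HOL-Library.FuncSet" "HOL-Library.Countable_Set"
begin

definition tuples :: "'a set \<Rightarrow> nat \<Rightarrow> 'a list set" where
  "tuples A k = {xs. length xs = k \<and> set xs \<subseteq> A}"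

text \<open>
  A function from \<open>A\<^sup>k\<close> to \<open>B\<close> is represented by a pair \<open>(k, f)\<close> with \<open>f\<close> extensional on
  \<open>tuples A k\<close>. The arity has to be recorded: the extensional function with constant value
  \<open>undefined\<close> belongs to \<open>tuples A k \<rightarrow>\<^sub>E B\<close> for every \<open>k\<close> if \<open>undefined \<in> B\<close>.
  Coordinates are numbered from 0.
\<close>

type_synonym ('a, 'b) fin_fun = "nat \<times> ('a list \<Rightarrow> 'b)"

definition fin_funs :: "'a set \<Rightarrow> 'b set \<Rightarrow> ('a, 'b) fin_fun set" where
  "fin_funs A B = {(k, f). 1 \<le> k \<and> f \<in> tuples A k \<rightarrow>\<^sub>E B}"

definition minor :: "'a set \<Rightarrow> nat \<Rightarrow> nat \<Rightarrow> (nat \<Rightarrow> nat) \<Rightarrow> ('a list \<Rightarrow> 'b) \<Rightarrow> 'a list \<Rightarrow> 'b" where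
  "minor A k l \<sigma> f = (\<lambda>xs\<in>tuples A l. f (map (\<lambda>i. xs ! \<sigma> i) [0..<k]))"

text \<open>
  \<open>compose_on A k f [g\<^sub>1, \<dots>, g\<^sub>n]\<close> is the \<open>k\<close>-ary function \<open>f(g\<^sub>1, \<dots>, g\<^sub>n)\<close> on \<open>A\<close>, that is, the
  result of applying \<open>f\<close> pointwise to \<open>k\<close>-ary functions \<open>g\<^sub>1, \<dots>, g\<^sub>n\<close>.
\<close>

definition compose_on ::
  "'a set \<Rightarrow> nat \<Rightarrow> ('b list \<Rightarrow> 'c) \<Rightarrow> ('a list \<Rightarrow> 'b) list \<Rightarrow> 'a list \<Rightarrow> 'c" where
  "compose_on A k f gs = (\<lambda>xs\<in>tuples A k. f (map (\<lambda>g. g xs) gs))"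

text \<open>Basic operations may be nullary.\<close>

definition is_algebra :: "'b set \<Rightarrow> ('b, 'b) fin_fun set \<Rightarrow> bool" where
  "is_algebra B F \<longleftrightarrow> (\<forall>(n, f)\<in>F. f \<in> tuples B n \<rightarrow>\<^sub>E B)"

inductive_set term_ops :: "'b set \<Rightarrow> ('b, 'b) fin_fun set \<Rightarrow> ('b, 'b) fin_fun set"
  for B :: "'b set" and F :: "('b, 'b) fin_fun set" where
  proj: "i < k \<Longrightarrow> (k, \<lambda>xs\<in>tuples B k. xs ! i) \<in> term_ops B F"
| basic: "(n, f) \<in> F \<Longrightarrow> (n, f) \<in> term_ops B F"
| comp: "(n, f) \<in> term_ops B F \<Longrightarrow> length gs = n \<Longrightarrow> \<forall>g\<in>set gs. (k, g) \<in> term_ops B F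
    \<Longrightarrow> (k, compose_on B k f gs) \<in> term_ops B F"

text \<open>
  The formal columns in \<open>{x, y}\<^sup>k\<close> are Boolean lists, where \<open>False\<close> stands for \<open>x\<close> and \<open>True\<close> for \<open>y\<close>.
  The order of the columns is left open; the list \<open>cols\<close> enumerates them without repetition, so its
  length is \<open>2 ^ k - 1\<close>.
\<close>

definition is_cube_term ::
  "'b set \<Rightarrow> ('b, 'b) fin_fun set \<Rightarrow> nat \<Rightarrow> ('b list \<Rightarrow> 'b) \<Rightarrow> bool" where
  "is_cube_term B F k c \<longleftrightarrow> 1 \<le> k \<and> (2 ^ k - 1, c) \<in> term_ops B F \<and>
     (\<exists>cols :: bool list list. distinct cols \<and>
        set cols = {v. length v = k} - {replicate k False} \<and>
        (\<forall>x\<in>B. \<forall>y\<in>B. \<forall>i<k. c (map (\<lambda>v. if v ! i then y else x) cols) = x))"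

definition has_cube_term :: "'b set \<Rightarrow> ('b, 'b) fin_fun set \<Rightarrow> bool" where
  "has_cube_term B F \<longleftrightarrow> (\<exists>k c. is_cube_term B F k c)"

definition is_clonoid ::
  "'a set \<Rightarrow> 'b set \<Rightarrow> ('b, 'b) fin_fun set \<Rightarrow> ('a, 'b) fin_fun set \<Rightarrow> bool" where
  "is_clonoid A B F C \<longleftrightarrow> C \<subseteq> fin_funs A B \<and>
     (\<forall>k l f \<sigma>. (k, f) \<in> C \<and> 1 \<le> l \<and> \<sigma> \<in> {..<k} \<rightarrow> {..<l} \<longrightarrow> (l, minor A k l \<sigma> f) \<in> C) \<and>
     (\<forall>k\<ge>1. \<forall>(n, f)\<in>F. \<forall>gs. length gs = n \<and> (\<forall>g\<in>set gs. (k, g) \<in> C)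
        \<longrightarrow> (k, compose_on A k f gs) \<in> C)"

text \<open>
  A pair of \<open>m\<close>-ary relations \<open>P\<close>, \<open>Q\<close> is the triple \<open>(m, P, Q)\<close>. The arity \<open>m = 0\<close> is allowed; this
  only matters for \<open>A = {}\<close>, where no pair of relations of positive arity excludes any function.
\<close>

type_synonym ('a, 'b) rel_pair = "nat \<times> 'a list set \<times> 'b list set"

definition is_rel_pair :: "'a set \<Rightarrow> 'b set \<Rightarrow> ('a, 'b) rel_pair \<Rightarrow> bool" where
  "is_rel_pair A B = (\<lambda>(m, P, Q). P \<subseteq> tuples A m \<and> Q \<subseteq> tuples B m)"

definition is_polymorphism :: "('a, 'b) fin_fun \<Rightarrow> ('a, 'b) rel_pair \<Rightarrow> bool" where
  "is_polymorphism = (\<lambda>(k, f) (m, P, Q).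
     \<forall>ps\<in>tuples P k. map (\<lambda>j. f (map (\<lambda>p. p ! j) ps)) [0..<m] \<in> Q)"

definition Pol :: "'a set \<Rightarrow> 'b set \<Rightarrow> ('a, 'b) rel_pair set \<Rightarrow> ('a, 'b) fin_fun set" where
  "Pol A B R = {h \<in> fin_funs A B. \<forall>r\<in>R. is_polymorphism h r}"

definition finitely_related :: "'a set \<Rightarrow> 'b set \<Rightarrow> ('a, 'b) fin_fun set \<Rightarrow> bool" where
  "finitely_related A B C \<longleftrightarrow> (\<exists>R. finite R \<and> (\<forall>r\<in>R. is_rel_pair A B r) \<and> C = Pol A B R)"

end

(*
Let D_m be the set of all functions whose m-ary minors belong to the clonoid C. It is the set of
polymorphisms of a single pair of relations, so it suffices to show that D_m = C for some m.

Order A^n lexicographically. A fork of C at a is a pair (f(a), g(a)) where f, g in C agree on all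
smaller tuples. A cube term makes C_n determined, inside any larger set of n-ary functions, by its
projections to few coordinates and by its forks. If w arises from v by inserting letters that occur
earlier in the word, then identifying variables turns a fork at w into a fork at v; hence the words
without a given fork form an upper set for this embedding. The embedding is a well-quasi-order, by
Higman's lemma, so all forks are controlled by finitely many words, that is, by C_m for some m.
*)
theory Submission
  imports Defs Complex_Main "HOL-Library.Sublist" "HOL-Library.Ramsey"
begin

subsection \<open>Well-quasi-orders on words\<close>

text \<open>Forks enter because agreement is extended one coordinate at a time. Let r in C_n agree
  with s before a. Then (r(a), s(a)) is a fork of the larger set, and if C has this fork as well,
  through u and v, a term can use u and v to replace r(a) by s(a) while keeping correct values where
  u = v. The bare cube identities do not suffice: if the letter y of a row occurs in several
  columns, several arguments must share the same wrong value at a coordinate. Nested use of the cube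
  operation removes such columns until, apart from one distinguished row, each column is a
  singleton. That row is the slot for the fork; each other row tolerates one argument with an
  arbitrary error at one point. The same nested formula serves for the elimination and for the
  correction.

  The embedding must be finer than the subsequence order: substitution has to send lexicographically
  smaller tuples to smaller tuples, so first occurrences of positions must keep their order.
  Higman's lemma is therefore applied to the stretches between first occurrences of new letters. The
  possible forks lie in the finite set B x B, so one length bound serves them all.\<close>

text \<open>Asking for a subsequence with \<open>P\<close> between any two terms, instead of one
  good pair, lets unions and products be treated by refining subsequences. Ramsey's theorem is then
  needed only once, in \<open>wqo_on_if_good\<close>.\<close>

definition wqo_on :: "('x \<Rightarrow> 'x \<Rightarrow> bool) \<Rightarrow> 'x set \<Rightarrow> bool" where
  "wqo_on P X \<longleftrightarrow> (\<forall>f :: nat \<Rightarrow> 'x. range f \<subseteq> X \<longrightarrow>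
     (\<exists>r :: nat \<Rightarrow> nat. strict_mono r \<and> (\<forall>i j. i < j \<longrightarrow> P (f (r i)) (f (r j)))))"

lemma wqo_onD:
  assumes "wqo_on P X" and "\<And>i. f i \<in> X"
  obtains r :: "nat \<Rightarrow> nat" where "strict_mono r" "\<And>i j. i < j \<Longrightarrow> P (f (r i)) (f (r j))"
  using assms unfolding wqo_on_def by blast

lemma wqo_on_mono:
  fixes P Q :: "'x \<Rightarrow> 'x \<Rightarrow> bool"
  assumes "wqo_on P X" and "Y \<subseteq> X" and "\<And>x y. x \<in> Y \<Longrightarrow> y \<in> Y \<Longrightarrow> P x y \<Longrightarrow> Q x y"
  shows "wqo_on Q Y"
  unfolding wqo_on_def
proof (intro allI impI)
  fix f :: "nat \<Rightarrow> 'x"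
  assume f: "range f \<subseteq> Y"
  then obtain r :: "nat \<Rightarrow> nat" where "strict_mono r" "\<And>i j. i < j \<Longrightarrow> P (f (r i)) (f (r j))"
    using wqo_onD[OF assms(1), of f] assms(2) by blast
  then show "\<exists>r :: nat \<Rightarrow> nat. strict_mono r \<and> (\<forall>i j. i < j \<longrightarrow> Q (f (r i)) (f (r j)))"
    using f assms(3) by - (rule exI[of _ r], auto simp: image_subset_iff)
qed

lemma wqo_on_UN:
  fixes P :: "'x \<Rightarrow> 'x \<Rightarrow> bool"
  assumes "finite I" and "\<And>i. i \<in> I \<Longrightarrow> wqo_on P (X i)"
  shows "wqo_on P (\<Union>i\<in>I. X i)"
  unfolding wqo_on_def
proof (intro allI impI)
  fix f :: "nat \<Rightarrow> 'x"
  assume f: "range f \<subseteq> (\<Union>i\<in>I. X i)"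
  have "\<exists>i\<in>I. infinite {n. f n \<in> X i}"
  proof (rule ccontr)
    assume "\<not> ?thesis"
    then have "finite (\<Union>i\<in>I. {n. f n \<in> X i})" using assms(1) by blast
    moreover have "(\<Union>i\<in>I. {n. f n \<in> X i}) = UNIV" using f by blast
    ultimately show False by simp
  qed
  then obtain i where i: "i \<in> I" and "infinite {n. f n \<in> X i}" by blast
  then obtain e :: "nat \<Rightarrow> nat" where e: "strict_mono e" "\<And>n. f (e n) \<in> X i"
    using infinite_enumerate by (metis mem_Collect_eq)
  obtain r :: "nat \<Rightarrow> nat" where "strict_mono r" "\<And>j k. j < k \<Longrightarrow> P (f (e (r j))) (f (e (r k)))"
    using wqo_onD[OF assms(2)[OF i], of "\<lambda>n. f (e n)"] e(2) by blast
  then show "\<exists>r :: nat \<Rightarrow> nat. strict_mono r \<and> (\<forall>i j. i < j \<longrightarrow> P (f (r i)) (f (r j)))"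
    using strict_mono_o[OF e(1)] by - (rule exI[of _ "e \<circ> r"], simp)
qed

lemma wqo_on_Un:
  assumes "wqo_on P X" and "wqo_on P Y"
  shows "wqo_on P (X \<union> Y)"
  using wqo_on_UN[of "UNIV :: bool set" P "\<lambda>b. if b then X else Y"] assms
  by (simp add: UNIV_bool Un_commute)

text \<open>Products occur only as factorizations \<open>p @ x # q\<close> of words, so the map
  \<open>h\<close> that assembles the factors is built in.\<close>

lemma wqo_on_image2:
  fixes h :: "'x \<Rightarrow> 'y \<Rightarrow> 'z"
  assumes "wqo_on P X" and "wqo_on Q Y"
    and "\<And>x x' y y'. x \<in> X \<Longrightarrow> x' \<in> X \<Longrightarrow> y \<in> Y \<Longrightarrow> y' \<in> Y \<Longrightarrow> P x x' \<Longrightarrow> Q y y'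
      \<Longrightarrow> S (h x y) (h x' y')"
  shows "wqo_on S {h x y |x y. x \<in> X \<and> y \<in> Y}"
  unfolding wqo_on_def
proof (intro allI impI)
  fix f :: "nat \<Rightarrow> 'z"
  assume "range f \<subseteq> {h x y |x y. x \<in> X \<and> y \<in> Y}"
  then have "\<forall>n. \<exists>x y. x \<in> X \<and> y \<in> Y \<and> f n = h x y" by blast
  then obtain a b where ab: "\<And>n. a n \<in> X" "\<And>n. b n \<in> Y" "\<And>n. f n = h (a n) (b n)" by metis
  obtain r :: "nat \<Rightarrow> nat" where r: "strict_mono r" "\<And>i j. i < j \<Longrightarrow> P (a (r i)) (a (r j))"
    using wqo_onD[OF assms(1), of a] ab(1) by blast
  obtain q :: "nat \<Rightarrow> nat" where q: "strict_mono q" "\<And>i j. i < j \<Longrightarrow> Q (b (r (q i))) (b (r (q j)))"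
    using wqo_onD[OF assms(2), of "\<lambda>n. b (r n)"] ab(2) by blast
  have "S (f ((r \<circ> q) i)) (f ((r \<circ> q) j))" if "i < j" for i j
    unfolding ab(3) comp_def
    using that by (intro assms(3) ab(1,2) q(2) r(2) strict_monoD[OF q(1)])
  with strict_mono_o[OF r(1) q(1)]
  show "\<exists>r :: nat \<Rightarrow> nat. strict_mono r \<and> (\<forall>i j. i < j \<longrightarrow> S (f (r i)) (f (r j)))" by - (rule exI[of _ "r \<circ> q"], simp)
qed

text \<open>Colour a pair of indices by whether \<open>P\<close> holds from the earlier to the later
  term. Along a homogeneous infinite set a single good pair decides the colour of all pairs.\<close>

lemma wqo_on_if_good:
  assumes "\<And>f :: nat \<Rightarrow> 'x. range f \<subseteq> X \<Longrightarrow> \<exists>i j. i < j \<and> P (f i) (f j)"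
  shows "wqo_on P X"
  unfolding wqo_on_def
proof (intro allI impI)
  fix f :: "nat \<Rightarrow> 'x"
  assume f: "range f \<subseteq> X"
  define c where "c I = (if P (f (Min I)) (f (Max I)) then 0 else 1 :: nat)" for I
  obtain Y t where Y: "infinite Y" and c: "\<forall>i\<in>Y. \<forall>j\<in>Y. i \<noteq> j \<longrightarrow> c {i, j} = t"
  proof -
    have "\<forall>i\<in>UNIV. \<forall>j\<in>UNIV. i \<noteq> j \<longrightarrow> c {i, j} < 2" by (simp add: c_def)
    from Ramsey2[OF infinite_UNIV_nat this] show thesis using that by blast
  qed
  obtain r :: "nat \<Rightarrow> nat" where r: "strict_mono r" "\<And>n. r n \<in> Y"
    using infinite_enumerate[OF Y] by blast
  have eq: "c {r i, r j} = (if P (f (r i)) (f (r j)) then 0 else 1)" if "i < j" for i j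
    using strict_monoD[OF r(1) that] by (simp add: c_def min_def max_def)
  have t: "c {r i, r j} = t" if "i < j" for i j
    using c r(2) strict_monoD[OF r(1) that] by (metis less_irrefl)
  obtain i j where "i < j" "P (f (r i)) (f (r j))"
    using assms[of "\<lambda>n. f (r n)"] f by blast
  then have "t = 0" using eq t by metis
  then have "\<forall>i j. i < j \<longrightarrow> P (f (r i)) (f (r j))" using eq t by (metis zero_neq_one)
  with r(1) show "\<exists>r :: nat \<Rightarrow> nat. strict_mono r \<and> (\<forall>i j. i < j \<longrightarrow> P (f (r i)) (f (r j)))" by blast
qed


text \<open>
  The words avoiding \<open>x # w\<close> as a subsequence are those without \<open>x\<close> and the words \<open>p @ x # q\<close> where
  \<open>p\<close> lacks \<open>x\<close> and \<open>q\<close> avoids \<open>w\<close>.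
\<close>

lemma wqo_on_avoiding:
  assumes "\<And>x. x \<in> A \<Longrightarrow> wqo_on subseq (lists (A - {x}))"
  shows "w \<in> lists A \<Longrightarrow> wqo_on subseq {v \<in> lists A. \<not> subseq w v}"
proof (induction w)
  case Nil
  then show ?case by (simp add: wqo_on_def)
next
  case (Cons x w)
  let ?H = "{p @ x # q |p q. p \<in> lists (A - {x}) \<and> q \<in> {v \<in> lists A. \<not> subseq w v}}"
  from Cons.prems have x: "x \<in> A" and w: "w \<in> lists A" by simp_all
  have H: "wqo_on subseq ?H"
    by (rule wqo_on_image2[OF assms[OF x] Cons.IH[OF w]]) (simp add: list_emb_append_mono)
  have sub: "{v \<in> lists A. \<not> subseq (x # w) v} \<subseteq> lists (A - {x}) \<union> ?H"
  proof
    fix v assume v: "v \<in> {v \<in> lists A. \<not> subseq (x # w) v}"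
    show "v \<in> lists (A - {x}) \<union> ?H"
    proof (cases "x \<in> set v")
      case True
      then obtain p q where pq: "v = p @ x # q" "x \<notin> set p"
        using split_list_first by metis
      have "\<not> subseq w q"
      proof
        assume "subseq w q"
        then have "subseq (x # w) v" unfolding pq(1) by (simp add: list_emb_append2)
        with v show False by simp
      qed
      moreover have "p \<in> lists (A - {x})" "q \<in> lists A" using v pq by auto
      ultimately have "v \<in> ?H" using pq(1) by blast
      then show ?thesis ..
    next
      case False
      with v have "v \<in> lists (A - {x})" by auto
      then show ?thesis ..
    qed
  qed
  show ?case by (rule wqo_on_mono[OF wqo_on_Un[OF assms[OF x] H] sub])
qed

text \<open>Induction on the alphabet replaces a minimal bad sequence: in a bad sequence all later
  words avoid the first one, and the avoiding words are well-quasi-ordered because the smaller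
  alphabets are.\<close>

theorem Higman:
  assumes "finite A"
  shows "wqo_on subseq (lists A)"
  using assms
proof (induction A rule: finite_psubset_induct)
  case (psubset A)
  have sub: "wqo_on subseq (lists (A - {x}))" if "x \<in> A" for x
    using psubset.IH[of "A - {x}"] that by blast
  show ?case
  proof (rule wqo_on_if_good, rule ccontr)
    fix f :: "nat \<Rightarrow> 'a list"
    assume f: "range f \<subseteq> lists A" and bad: "\<not> (\<exists>i j. i < j \<and> subseq (f i) (f j))"
    have f0: "f 0 \<in> lists A" using f by blast
    have "f (Suc i) \<in> {v \<in> lists A. \<not> subseq (f 0) v}" for i
      using f bad by blast
    then obtain r :: "nat \<Rightarrow> nat" where r: "strict_mono r" "\<And>i j. i < j \<Longrightarrow> subseq (f (Suc (r i))) (f (Suc (r j)))"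
      using wqo_onD[OF wqo_on_avoiding[OF sub f0], of "\<lambda>i. f (Suc i)"] by blast
    have "Suc (r 0) < Suc (r 1)" using strict_monoD[OF r(1), of 0 1] by simp
    with r(2)[of 0 1] bad show False by auto
  qed
qed

text \<open>
  \<open>S\<close> collects the letters already read. An inserted letter repeats one of them, so it is mapped to
  an earlier position and the first occurrences of the positions of \<open>v\<close> keep their order.
\<close>

inductive word_emb :: "'a set \<Rightarrow> 'a list \<Rightarrow> 'a list \<Rightarrow> bool" where
  nil: "word_emb S [] []"
| keep: "word_emb (insert x S) v w \<Longrightarrow> word_emb S (x # v) (x # w)"
| ins: "y \<in> S \<Longrightarrow> word_emb S v w \<Longrightarrow> word_emb S v (y # w)"

lemma word_emb_append:
  assumes "subseq v w" and "set w \<subseteq> S" and "word_emb S v' w'"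
  shows "word_emb S (v @ v') (w @ w')"
  using assms
proof (induction rule: list_emb.induct)
  case (list_emb_Nil ys)
  then show ?case by (induction ys) (auto intro: word_emb.ins)
next
  case (list_emb_Cons xs ys y)
  then show ?case by (auto intro: word_emb.ins)
next
  case (list_emb_Cons2 x y xs ys)
  then show ?case by (auto intro!: word_emb.keep simp: insert_absorb)
qed

text \<open>Induction on the number of unread letters. A word is cut at its first letter
  \<open>x\<close> outside \<open>S\<close>: before the cut every letter may be inserted, so
  Higman's lemma applies; after it, \<open>x\<close> joins \<open>S\<close>. Words without such a
  letter are again a case for Higman's lemma.\<close>

lemma wqo_on_word_emb:
  assumes "finite A"
  shows "S \<subseteq> A \<Longrightarrow> wqo_on (word_emb S) (lists A)"
proof (induction "card (A - S)" arbitrary: S rule: less_induct)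
  case less
  let ?H = "\<lambda>x. {p @ x # q |p q. p \<in> lists S \<and> q \<in> lists A}"
  have fin: "finite S" using less.prems assms finite_subset by blast
  have H: "wqo_on (word_emb S) (?H x)" if x: "x \<in> A - S" for x
  proof (rule wqo_on_image2[OF Higman[OF fin]])
    have "A - insert x S \<subset> A - S" using x by blast
    then have "card (A - insert x S) < card (A - S)"
      using assms by (simp add: psubset_card_mono)
    then show "wqo_on (word_emb (insert x S)) (lists A)"
      using less x by simp
    show "word_emb S (p @ x # q) (p' @ x # q')"
      if "p' \<in> lists S" "subseq p p'" "word_emb (insert x S) q q'" for p p' q q'
      using that by (auto intro!: word_emb_append word_emb.keep)
  qed
  have S: "wqo_on (word_emb S) (lists S)"
  proof (rule wqo_on_mono[OF Higman[OF fin] order_refl])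
    show "word_emb S v w" if "w \<in> lists S" "subseq v w" for v w
      using word_emb_append[OF that(2) _ word_emb.nil] that(1) by auto
  qed
  have "lists A \<subseteq> lists S \<union> (\<Union>x\<in>A - S. ?H x)"
  proof
    fix v assume v: "v \<in> lists A"
    show "v \<in> lists S \<union> (\<Union>x\<in>A - S. ?H x)"
    proof (cases "\<exists>y\<in>set v. y \<notin> S")
      case True
      then obtain p x q where pq: "v = p @ x # q" "x \<notin> S" "\<forall>y\<in>set p. y \<in> S"
        using split_list_first_prop[of v "\<lambda>y. y \<notin> S"] by blast
      have "x \<in> A - S" "p \<in> lists S" "q \<in> lists A" using v pq by auto
      with pq(1) show ?thesis by blast
    qed (use v in auto)
  qed
  moreover have "wqo_on (word_emb S) (lists S \<union> (\<Union>x\<in>A - S. ?H x))"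
    by (intro wqo_on_Un wqo_on_UN S H) (use assms in auto)
  ultimately show ?case using wqo_on_mono by blast
qed

text \<open>If every bound \<open>m\<close> failed at some word \<open>f m\<close>, then along the
  good subsequence \<open>f (r 0)\<close> would lie below each later \<open>f (r j)\<close>, which
  forces \<open>r j < size (f (r 0))\<close> although \<open>r\<close> is unbounded.\<close>

lemma wqo_on_finite_basis:
  fixes size :: "'x \<Rightarrow> nat"
  assumes "wqo_on P X" and "U \<subseteq> X"
  shows "\<exists>m. \<forall>w\<in>U. \<exists>v\<in>U. P v w \<and> size v \<le> m"
proof (rule ccontr)
  assume "\<not> ?thesis"
  then have "\<forall>m. \<exists>w. w \<in> U \<and> (\<forall>v\<in>U. P v w \<longrightarrow> m < size v)" by (meson not_less)
  then obtain f where f: "\<And>m. f m \<in> U" "\<And>m v. v \<in> U \<Longrightarrow> P v (f m) \<Longrightarrow> m < size v" by metis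
  obtain r :: "nat \<Rightarrow> nat" where r: "strict_mono r" "\<And>i j. i < j \<Longrightarrow> P (f (r i)) (f (r j))"
    using wqo_onD[OF assms(1), of f] f(1) assms(2) by blast
  have "r (Suc (size (f (r 0)))) < size (f (r 0))"
    using f(1) r(2) by (intro f(2)) auto
  then show False
    using strict_mono_imp_increasing[OF r(1), of "Suc (size (f (r 0)))"] by simp
qed

text \<open>The list \<open>pre\<close> turns the set \<open>S\<close> into positions: an inserted
  letter is sent to a position in \<open>pre\<close>, a kept letter opens the next position of
  \<open>v\<close>. Hence each position of \<open>v\<close> is first reached after only smaller
  ones.\<close>

lemma word_emb_minor:
  assumes "word_emb S v w" and "set pre = S"
  shows "\<exists>\<sigma>. (\<forall>i<length w. \<sigma> i < length (pre @ v) \<and> w ! i = (pre @ v) ! \<sigma> i) \<and>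
    (\<forall>p. length pre \<le> p \<and> p < length (pre @ v) \<longrightarrow> (\<exists>i<length w. \<sigma> i = p \<and> (\<forall>j<i. \<sigma> j < p)))"
  using assms
proof (induction arbitrary: pre rule: word_emb.induct)
  case (nil S)
  then show ?case by simp
next
  case (keep x S v w)
  from keep.IH[of "pre @ [x]"] keep.prems
  obtain \<sigma> where s: "\<And>i. i < length w \<Longrightarrow> \<sigma> i < length (pre @ x # v) \<and> w ! i = (pre @ x # v) ! \<sigma> i"
    "\<And>p. length pre < p \<Longrightarrow> p < length (pre @ x # v) \<Longrightarrow> \<exists>i<length w. \<sigma> i = p \<and> (\<forall>j<i. \<sigma> j < p)"
    by (auto simp: Suc_le_eq)
  let ?s = "case_nat (length pre) \<sigma>"
  show ?case
  proof (intro exI[of _ ?s] conjI allI impI)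
    fix i assume "i < length (x # w)"
    then show "?s i < length (pre @ x # v)" "(x # w) ! i = (pre @ x # v) ! ?s i"
      using s(1) by (auto split: nat.split)
  next
    fix p assume p: "length pre \<le> p \<and> p < length (pre @ x # v)"
    show "\<exists>i<length (x # w). ?s i = p \<and> (\<forall>j<i. ?s j < p)"
    proof (cases "p = length pre")
      case True
      then show ?thesis by (intro exI[of _ 0]) simp
    next
      case False
      with p s(2)[of p] obtain i where "i < length w" "\<sigma> i = p" "\<forall>j<i. \<sigma> j < p" by auto
      with False p show ?thesis by - (rule exI[of _ "Suc i"], auto split: nat.split)
    qed
  qed
next
  case (ins y S v w)
  from ins.IH[OF ins.prems]
  obtain \<sigma> where s: "\<And>i. i < length w \<Longrightarrow> \<sigma> i < length (pre @ v) \<and> w ! i = (pre @ v) ! \<sigma> i"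
    "\<And>p. length pre \<le> p \<Longrightarrow> p < length (pre @ v) \<Longrightarrow> \<exists>i<length w. \<sigma> i = p \<and> (\<forall>j<i. \<sigma> j < p)"
    by auto
  from ins obtain q where q: "q < length pre" "pre ! q = y" by (metis in_set_conv_nth)
  let ?s = "case_nat q \<sigma>"
  show ?case
  proof (intro exI[of _ ?s] conjI allI impI)
    fix i assume "i < length (y # w)"
    then show "?s i < length (pre @ v)" "(y # w) ! i = (pre @ v) ! ?s i"
      using s(1) q by (auto split: nat.split simp: nth_append)
  next
    fix p assume p: "length pre \<le> p \<and> p < length (pre @ v)"
    with s(2)[of p] obtain i where "i < length w" "\<sigma> i = p" "\<forall>j<i. \<sigma> j < p" by auto
    with p q show "\<exists>i<length (y # w). ?s i = p \<and> (\<forall>j<i. ?s j < p)"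
      by - (rule exI[of _ "Suc i"], auto split: nat.split)
  qed
qed

subsection \<open>Forks and cube terms\<close>

text \<open>
  An operation \<open>T\<close> takes a family of arguments indexed by columns, a column in \<open>{x, y}\<^sup>k\<close> being given
  by the set \<open>K\<close> of the rows with entry \<open>y\<close>. Only the columns in \<open>\<Gamma>\<close> matter. \<open>R\<close> plays the role of
  a subalgebra of the power of the target algebra with exponent \<open>X\<close>.
\<close>

definition label_op ::
  "nat \<Rightarrow> 'b set \<Rightarrow> 'x set \<Rightarrow> ('x \<Rightarrow> 'b) set \<Rightarrow> nat set set \<Rightarrow> ((nat set \<Rightarrow> 'b) \<Rightarrow> 'b) \<Rightarrow> bool" where
  "label_op k B X R \<Gamma> T \<longleftrightarrow>
     (\<forall>g. (\<forall>K\<in>\<Gamma>. g K \<in> B) \<longrightarrow> T g \<in> B) \<and>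
     (\<forall>g g'. (\<forall>K\<in>\<Gamma>. g K = g' K) \<longrightarrow> T g = T g') \<and>
     (\<forall>i<k. \<forall>x\<in>B. \<forall>y\<in>B. T (\<lambda>K. if i \<in> K then y else x) = x) \<and>
     (\<forall>G. (\<forall>K\<in>\<Gamma>. G K \<in> R) \<longrightarrow> (\<lambda>x\<in>X. T (\<lambda>K. G K x)) \<in> R)"

lemma label_opD:
  assumes "label_op k B X R \<Gamma> T"
  shows "\<And>g. (\<And>K. K \<in> \<Gamma> \<Longrightarrow> g K \<in> B) \<Longrightarrow> T g \<in> B"
    and "\<And>g g'. (\<And>K. K \<in> \<Gamma> \<Longrightarrow> g K = g' K) \<Longrightarrow> T g = T g'"
    and "\<And>i x y. i < k \<Longrightarrow> x \<in> B \<Longrightarrow> y \<in> B \<Longrightarrow> T (\<lambda>K. if i \<in> K then y else x) = x"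
    and "\<And>G. (\<And>K. K \<in> \<Gamma> \<Longrightarrow> G K \<in> R) \<Longrightarrow> (\<lambda>x\<in>X. T (\<lambda>K. G K x)) \<in> R"
  using assms unfolding label_op_def by blast+

text \<open>
  Given a fork \<open>u, v\<close> at the coordinate \<open>f\<close>, the second branch moves the \<open>f\<close>-th entry of
  \<open>z (K - {f})\<close> to \<open>T (\<lambda>M. if M = {f} then a else b)\<close> and changes nothing where \<open>u\<close> and \<open>v\<close> agree.
\<close>

definition fork_op ::
  "nat \<Rightarrow> ((nat set \<Rightarrow> 'b) \<Rightarrow> 'b) \<Rightarrow> (nat set \<Rightarrow> 'b) \<Rightarrow> 'b \<Rightarrow> 'b \<Rightarrow> 'b \<Rightarrow> 'b" where
  "fork_op f T z e u v = T (\<lambda>K.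
     if K = {f} then T (\<lambda>M. if M = {f} then e else z (M - {f}))
     else if f \<in> K then T (\<lambda>M. if f \<notin> M then z (K - {f}) else if M = {f} then u else v)
     else z (K - {f}))"

lemma fork_op_in:
  assumes T: "label_op k B X R \<Gamma> T"
    and "e \<in> B" "u \<in> B" "v \<in> B" "\<And>K. K \<in> \<Gamma> \<Longrightarrow> K \<noteq> {f} \<Longrightarrow> z (K - {f}) \<in> B"
  shows "fork_op f T z e u v \<in> B"
  unfolding fork_op_def
  by (rule label_opD(1)[OF T]) (simp add: assms(2-) label_opD(1)[OF T] del: Diff_insert0)

lemma fork_op_closed:
  assumes T: "label_op k B X R \<Gamma> T"
    and "e \<in> R" "u \<in> R" "v \<in> R" "\<And>K. K \<in> \<Gamma> \<Longrightarrow> K \<noteq> {f} \<Longrightarrow> z (K - {f}) \<in> R"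
  shows "(\<lambda>x\<in>X. fork_op f T (\<lambda>K. z K x) (e x) (u x) (v x)) \<in> R"
proof -
  define G where "G K =
    (if K = {f} then \<lambda>x\<in>X. T (\<lambda>M. (if M = {f} then e else z (M - {f})) x)
     else if f \<in> K then \<lambda>x\<in>X. T (\<lambda>M. (if f \<notin> M then z (K - {f}) else if M = {f} then u else v) x)
     else z (K - {f}))" for K
  have "(\<lambda>x\<in>X. T (\<lambda>K. G K x)) \<in> R"
    by (rule label_opD(4)[OF T]) (simp add: G_def assms(2-) label_opD(4)[OF T] del: Diff_insert0)
  also have "(\<lambda>x\<in>X. T (\<lambda>K. G K x)) = (\<lambda>x\<in>X. fork_op f T (\<lambda>K. z K x) (e x) (u x) (v x))"
    unfolding fork_op_def
    by (rule restrict_ext, rule arg_cong[of _ _ T]) (auto simp: G_def fun_eq_iff if_distribR intro!: arg_cong[of _ _ T])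
  finally show ?thesis .
qed

lemma fork_op_cong:
  assumes T: "label_op k B X R \<Gamma> T" and "\<And>K. K \<in> \<Gamma> \<Longrightarrow> K \<noteq> {f} \<Longrightarrow> z (K - {f}) = z' (K - {f})"
  shows "fork_op f T z e u v = fork_op f T z' e u v"
proof -
  have "T (\<lambda>M. if M = {f} then e else z (M - {f})) = T (\<lambda>M. if M = {f} then e else z' (M - {f}))"
    by (rule label_opD(2)[OF T]) (simp add: assms(2))
  moreover have "T (\<lambda>M. if f \<notin> M then z (K - {f}) else if M = {f} then u else v) =
      T (\<lambda>M. if f \<notin> M then z' (K - {f}) else if M = {f} then u else v)"
    if "K \<in> \<Gamma>" "K \<noteq> {f}" for K
    by (subst assms(2)[OF that]) (rule refl)
  ultimately show ?thesis
    unfolding fork_op_def by (intro label_opD(2)[OF T]) (simp add: assms(2) del: Diff_insert0)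
qed

text \<open>When the two branches carry the same value \<open>w\<close>, the identity of row
  \<open>f\<close> collapses each inner term to \<open>z (K - {f})\<close>. What remains is one
  application of \<open>T\<close> with \<open>e\<close> at \<open>{f}\<close>, so a fixed-point
  condition on \<open>e\<close> is enough.\<close>

lemma fork_op_same:
  assumes T: "label_op k B X R \<Gamma> T" and "f < k" "w \<in> B"
    and "\<And>K. K \<in> \<Gamma> \<Longrightarrow> K \<noteq> {f} \<Longrightarrow> z (K - {f}) \<in> B"
    and e: "T (\<lambda>K. if K = {f} then e else z (K - {f})) = e"
  shows "fork_op f T z e w w = e"
proof -
  have "T (\<lambda>M. if f \<notin> M then z (K - {f}) else if M = {f} then w else w) = z (K - {f})"
    if "K \<in> \<Gamma>" "K \<noteq> {f}" for K
  proof -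
    have "(\<lambda>M. if f \<notin> M then z (K - {f}) else if M = {f} then w else w) =
        (\<lambda>M. if f \<in> M then w else z (K - {f}))" by auto
    with label_opD(3)[OF T assms(2) assms(4)[OF that] assms(3)] show ?thesis by simp
  qed
  then have "fork_op f T z e w w = T (\<lambda>K. if K = {f} then e else z (K - {f}))"
    unfolding fork_op_def by (intro label_opD(2)[OF T]) (simp add: e del: Diff_insert0)
  with e show ?thesis by simp
qed

lemma fork_op_pattern:
  assumes T: "label_op k B X R \<Gamma> T" and "f < k" "j < k" "j \<noteq> f" "x \<in> B" "y \<in> B" "w \<in> B"
    and z: "\<And>K. K \<in> \<Gamma> \<Longrightarrow> K \<noteq> {f} \<Longrightarrow> z (K - {f}) = (if j \<in> K then y else x)"
  shows "fork_op f T z x w w = x"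
proof (rule fork_op_same[OF T])
  have "T (\<lambda>K. if K = {f} then x else z (K - {f})) = T (\<lambda>K. if j \<in> K then y else x)"
    by (rule label_opD(2)[OF T]) (use z assms(4) in auto)
  also have "\<dots> = x" using label_opD(3)[OF T] assms by blast
  finally show "T (\<lambda>K. if K = {f} then x else z (K - {f})) = x" .
qed (use assms in auto)

lemma fork_op_const:
  assumes T: "label_op k B X R \<Gamma> T" and "f < k" "x \<in> B" "w \<in> B"
    and z: "\<And>K. K \<in> \<Gamma> \<Longrightarrow> K \<noteq> {f} \<Longrightarrow> z (K - {f}) = x"
  shows "fork_op f T z x w w = x"
proof (rule fork_op_same[OF T])
  have "T (\<lambda>K. if K = {f} then x else z (K - {f})) = T (\<lambda>K. if f \<in> K then x else x)"
    by (rule label_opD(2)[OF T]) (use z in auto)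
  also have "\<dots> = x" using label_opD(3)[OF T] assms by blast
  finally show "T (\<lambda>K. if K = {f} then x else z (K - {f})) = x" .
qed (use assms in auto)

text \<open>Both kinds of inner term evaluate to the same \<open>d\<close>: one has \<open>a\<close>
  from \<open>e\<close> at \<open>{f}\<close>, the other has it from \<open>u\<close>. The outer
  application is thus the pattern of row \<open>f\<close> with letters \<open>b\<close> and
  \<open>d\<close>, which returns \<open>b\<close>.\<close>

lemma fork_op_at_fork:
  assumes T: "label_op k B X R \<Gamma> T" and "f < k" "a \<in> B" "b \<in> B"
    and z: "\<And>K. K \<in> \<Gamma> \<Longrightarrow> K \<noteq> {f} \<Longrightarrow> z (K - {f}) = b"
  shows "fork_op f T z a a b = b"
proof -
  define d where "d = T (\<lambda>M. if M = {f} then a else b)"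
  have d: "d \<in> B" unfolding d_def by (rule label_opD(1)[OF T]) (use assms in auto)
  have 1: "T (\<lambda>M. if M = {f} then a else z (M - {f})) = d"
    unfolding d_def by (rule label_opD(2)[OF T]) (use z in auto)
  have 2: "T (\<lambda>M. if f \<notin> M then z (K - {f}) else if M = {f} then a else b) = d"
    if "K \<in> \<Gamma>" "K \<noteq> {f}" for K
    unfolding d_def by (rule label_opD(2)[OF T]) (use z that in auto)
  have "fork_op f T z a a b = T (\<lambda>K. if f \<in> K then d else b)"
    unfolding fork_op_def by (rule label_opD(2)[OF T]) (auto simp: 1 2 z simp del: Diff_insert0)
  also have "\<dots> = b" using label_opD(3)[OF T] assms d by blast
  finally show ?thesis .
qed

text \<open>The formal columns \<open>{f}\<close>, \<open>{f, l}\<close>, \<open>{l}\<close> serve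
  as \<open>e\<close>, \<open>u\<close>, \<open>v\<close>. In row \<open>f\<close> their entries are
  y, y, x, a formal fork; in every other row \<open>u\<close> and \<open>v\<close> agree. So row
  \<open>f\<close> is handled by these three columns and can be deleted from all the others.\<close>

lemma label_op_step:
  assumes T: "label_op k B X R \<Gamma> T" and "{} \<notin> \<Gamma>" "f < k" "l < k" "f \<noteq> l"
  shows "label_op k B X R (((\<lambda>K. K - {f}) ` \<Gamma> - {{}}) \<union> {{f}, {f, l}, {l}})
    (\<lambda>g. fork_op f T g (g {f}) (g {f, l}) (g {l}))" (is "label_op k B X R ?\<Gamma> ?T")
proof -
  have \<Gamma>: "K - {f} \<in> ?\<Gamma>" if "K \<in> \<Gamma>" "K \<noteq> {f}" for K
  proof -
    from that assms(2) have "K \<noteq> {}" "K \<noteq> {f}" by auto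
    then have "K - {f} \<noteq> {}" by blast
    with that(1) show ?thesis by blast
  qed
  have "?T g \<in> B" if "\<forall>K\<in>?\<Gamma>. g K \<in> B" for g
    by (rule fork_op_in[OF T]; rule bspec[OF that]; (rule \<Gamma>; assumption)?) simp_all
  moreover have "?T g = ?T g'" if g: "\<forall>K\<in>?\<Gamma>. g K = g' K" for g g'
  proof -
    have "fork_op f T g e u v = fork_op f T g' e u v" for e u v
      by (rule fork_op_cong[OF T]) (rule bspec[OF g \<Gamma>])
    with g show ?thesis by simp
  qed
  moreover have "?T (\<lambda>K. if i \<in> K then y else x) = x" if i: "i < k" and B: "x \<in> B" "y \<in> B" for i x y
  proof (cases "i = f")
    case True
    have "fork_op f T (\<lambda>K. if i \<in> K then y else x) y y x = x"
      by (rule fork_op_at_fork[OF T]) (use assms B True in auto)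
    with True assms show ?thesis by simp
  next
    case False
    have "fork_op f T (\<lambda>K. if i \<in> K then y else x) x w w = x" if "w \<in> B" for w
      by (rule fork_op_pattern[OF T, of _ i _ y]) (use assms i B False that in auto)
    with False B show ?thesis by simp
  qed
  moreover have "(\<lambda>x\<in>X. ?T (\<lambda>K. G K x)) \<in> R" if "\<forall>K\<in>?\<Gamma>. G K \<in> R" for G
    by (rule fork_op_closed[OF T]; rule bspec[OF that]; (rule \<Gamma>; assumption)?) simp_all
  ultimately show ?thesis unfolding label_op_def by (intro conjI allI impI ballI)
qed

text \<open>
  Eliminating the rows \<open>0, \<dots>, l - 1\<close> one after the other leaves only columns of an edge term: the
  singletons and the sets \<open>{j, l}\<close>.
\<close>

lemma edge_like_label_op:
  assumes T: "label_op k B X R \<Gamma> T" and \<Gamma>: "{} \<notin> \<Gamma>" "\<forall>K\<in>\<Gamma>. K \<subseteq> {..<k}" and l: "k = Suc l"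
  obtains \<Gamma>' T' where "label_op k B X R \<Gamma>' T'" "\<And>K. K \<in> \<Gamma>' \<Longrightarrow> K \<noteq> {l} \<Longrightarrow> \<exists>j<l. K - {l} = {j}"
proof -
  have "m \<le> l \<Longrightarrow> \<exists>\<Gamma> T. label_op k B X R \<Gamma> T \<and> {} \<notin> \<Gamma> \<and> (\<forall>K\<in>\<Gamma>. K \<subseteq> {..<k}) \<and>
    (\<forall>K\<in>\<Gamma>. \<forall>j\<in>K. j < m \<longrightarrow> K \<subseteq> {j, l})" for m
  proof (induction m)
    case 0
    with T \<Gamma> show ?case by blast
  next
    case (Suc m)
    then obtain \<Gamma> T where T: "label_op k B X R \<Gamma> T" and \<Gamma>: "{} \<notin> \<Gamma>" "\<forall>K\<in>\<Gamma>. K \<subseteq> {..<k}"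
      "\<forall>K\<in>\<Gamma>. \<forall>j\<in>K. j < m \<longrightarrow> K \<subseteq> {j, l}" by auto
    let ?G = "((\<lambda>K. K - {m}) ` \<Gamma> - {{}}) \<union> {{m}, {m, l}, {l}}"
    from Suc.prems l have "m < k" "l < k" "m \<noteq> l" by auto
    note L = label_op_step[OF T \<Gamma>(1) this]
    have "\<forall>K\<in>?G. K \<subseteq> {..<k}" using \<Gamma>(2) \<open>m < k\<close> \<open>l < k\<close> by auto
    moreover have "K \<subseteq> {j, l}" if "K \<in> ?G" "j \<in> K" "j < Suc m" for K j
    proof (cases "K \<in> {{m}, {m, l}, {l}}")
      case True
      with that Suc.prems show ?thesis by auto
    next
      case False
      with that(1) obtain K' where K': "K' \<in> \<Gamma>" "K = K' - {m}" by blast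
      with that have "j \<in> K'" "j < m" by auto
      with \<Gamma>(3) K' show ?thesis by blast
    qed
    ultimately show ?case using L by blast
  qed
  from this[of l] obtain \<Gamma>' T' where T': "label_op k B X R \<Gamma>' T'" and \<Gamma>': "{} \<notin> \<Gamma>'"
    "\<forall>K\<in>\<Gamma>'. K \<subseteq> {..<k}" "\<forall>K\<in>\<Gamma>'. \<forall>j\<in>K. j < l \<longrightarrow> K \<subseteq> {j, l}" by auto
  have "\<exists>j<l. K - {l} = {j}" if K: "K \<in> \<Gamma>'" "K \<noteq> {l}" for K
  proof -
    from K \<Gamma>'(1) have "K \<noteq> {}" by auto
    with K(2) obtain j where j: "j \<in> K" "j \<noteq> l" by blast
    with K \<Gamma>'(2) l have "j < l" by fastforce
    with j K \<Gamma>'(3) have "K - {l} = {j}" by blast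
    with \<open>j < l\<close> show ?thesis by blast
  qed
  with T' show thesis using that by blast
qed

text \<open>
  An element of \<open>S\<close> is reached by elements of \<open>R\<close> that agree with it on longer and longer initial
  segments of the order given by \<open>rk\<close>. To extend the agreement to the next coordinate \<open>i\<close>, agreement
  on \<open>insert i Y\<close> is obtained by induction on \<open>card Y\<close>, from elements that may err at one point of \<open>Y\<close>.
\<close>

lemma subpower_eq_if_forks:
  fixes rk :: "'x \<Rightarrow> nat"
  assumes T: "label_op (Suc l) B X R \<Gamma> T"
    and \<Gamma>: "\<And>K. K \<in> \<Gamma> \<Longrightarrow> K \<noteq> {l} \<Longrightarrow> \<exists>j<l. K - {l} = {j}"
    and X: "finite X" "inj_on rk X"
    and R: "R \<subseteq> S" and S: "S \<subseteq> X \<rightarrow>\<^sub>E B"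
    and proj: "\<And>s Y. s \<in> S \<Longrightarrow> Y \<subseteq> X \<Longrightarrow> card Y \<le> Suc l \<Longrightarrow> \<exists>r\<in>R. \<forall>x\<in>Y. r x = s x"
    and forks: "\<And>i r s. i \<in> X \<Longrightarrow> r \<in> S \<Longrightarrow> s \<in> S \<Longrightarrow> \<forall>x\<in>X. rk x < rk i \<longrightarrow> r x = s x \<Longrightarrow>
      \<exists>u\<in>R. \<exists>v\<in>R. (\<forall>x\<in>X. rk x < rk i \<longrightarrow> u x = v x) \<and> u i = r i \<and> v i = s i"
  shows "R = S"
proof (rule antisym[OF R], rule subsetI)
  fix s assume s: "s \<in> S"
  have inB: "r x \<in> B" if "r \<in> S" "x \<in> X" for r x using subsetD[OF S that(1)] that(2) by auto
  have "\<exists>r\<in>R. \<forall>x\<in>X. rk x < m \<longrightarrow> r x = s x" for m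
  proof (induction m)
    case 0
    from proj[OF s, of "{}"] show ?case by simp
  next
    case (Suc m)
    then obtain r where r: "r \<in> R" "\<And>x. x \<in> X \<Longrightarrow> rk x < m \<Longrightarrow> r x = s x" by blast
    show ?case
    proof (cases "\<exists>i\<in>X. rk i = m")
      case False
      then have "rk x < m" if "x \<in> X" "rk x < Suc m" for x using that less_SucE by blast
      with r show ?thesis by blast
    next
      case True
      then obtain i where i: "i \<in> X" "rk i = m" by blast
      from R r(1) have rS: "r \<in> S" by blast
      obtain u v where uv: "u \<in> R" "v \<in> R" "\<And>x. x \<in> X \<Longrightarrow> rk x < m \<Longrightarrow> u x = v x"
        "u i = r i" "v i = s i"
        using forks[OF i(1) rS s] r(2) i(2) by blast
      from R uv have uvS: "u \<in> S" "v \<in> S" by auto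
      have "\<exists>q\<in>R. \<forall>x\<in>insert i Y. q x = s x" if "Y \<subseteq> {x \<in> X. rk x < m}" for Y
        using that
      proof (induction "card Y" arbitrary: Y rule: less_induct)
        case less
        have YX: "Y \<subseteq> X" using less.prems by blast
        note Y = finite_subset[OF YX X(1)] YX
        show ?case
        proof (cases "card Y \<le> l")
          case True
          then have "card (insert i Y) \<le> Suc l"
            using card_insert_le_m1[of "Suc l" Y i] by simp
          with proj[OF s, of "insert i Y"] Y(2) i(1) show ?thesis by simp
        next
          case False
          then obtain Z where Z: "Z \<subseteq> Y" "card Z = l" "finite Z"
            using obtain_subset_with_card_n[of l Y] nat_le_linear by metis
          then obtain t where t: "bij_betw t {..<l} Z"
            using ex_bij_betw_nat_finite[of Z] by (auto simp: atLeast0LessThan)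
          have tY: "t j \<in> Y" if "j < l" for j
            using t Z(1) that bij_betwE by blast
          have "\<exists>q\<in>R. \<forall>x\<in>insert i (Y - {t j}). q x = s x" if "j < l" for j
          proof (rule less.hyps)
            show "card (Y - {t j}) < card Y" using Y(1) tY[OF that] by (rule card_Diff1_less)
          qed (use less.prems in blast)
          then have "\<forall>j. \<exists>q. j < l \<longrightarrow> q \<in> R \<and> (\<forall>x\<in>insert i (Y - {t j}). q x = s x)" by blast
          then obtain z where z': "\<forall>j. j < l \<longrightarrow> z j \<in> R \<and> (\<forall>x\<in>insert i (Y - {t j}). z j x = s x)"
            by (rule choice[THEN exE])
          then have z: "\<And>j. j < l \<Longrightarrow> z j \<in> R"
            "\<And>j x. j < l \<Longrightarrow> x \<in> insert i (Y - {t j}) \<Longrightarrow> z j x = s x" by blast+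
          \<comment> \<open>The arguments are needed only at the labels \<open>K - {l}\<close>,
            which are singletons \<open>{j}\<close>.\<close>
          define zz where "zz K = z (the_elem K)" for K :: "nat set"
          have zz: "\<exists>j<l. K - {l} = {j} \<and> zz (K - {l}) = z j" if "K \<in> \<Gamma>" "K \<noteq> {l}" for K
            using \<Gamma>[OF that] by (auto simp: zz_def)
          define q where "q = (\<lambda>x\<in>X. fork_op l T (\<lambda>K. zz K x) (r x) (u x) (v x))"
          have "q \<in> R"
            unfolding q_def
          proof (rule fork_op_closed[OF T r(1) uv(1,2)])
            show "zz (K - {l}) \<in> R" if "K \<in> \<Gamma>" "K \<noteq> {l}" for K
              using zz[OF that] z(1) by auto
          qed
          moreover have "q x = s x" if x: "x \<in> insert i Y" for x
          proof -
            have xX: "x \<in> X" using x i(1) Y(2) by blast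
            have B: "s x \<in> B" "r x \<in> B" "u x \<in> B" "v x \<in> B"
              using inB xX s rS uvS by auto
            have "fork_op l T (\<lambda>K. zz K x) (r x) (u x) (v x) = s x"
            proof (cases "x = i")
              case True
              have "zz (K - {l}) i = s i" if "K \<in> \<Gamma>" "K \<noteq> {l}" for K
                using zz[OF that] z(2) by auto
              with fork_op_at_fork[OF T _ B(2) B(1)] uv(4,5) True show ?thesis by simp
            next
              case False
              with x less.prems have x': "x \<in> Y" "rk x < m" by auto
              then have eq: "r x = s x" "u x = v x" using r(2) uv(3) xX by auto
              show ?thesis
              proof (cases "x \<in> Z")
                case True
                then obtain j where j: "j < l" "t j = x"
                  using t unfolding bij_betw_def by auto
                have ne: "t j' \<noteq> x" if "j' < l" "j' \<noteq> j" for j'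
                  using t that j unfolding bij_betw_def inj_on_def by auto
                have R': "z j x \<in> B" using z(1)[OF j(1)] R inB xX by blast
                \<comment> \<open>At the point \<open>t j\<close> only the argument
                  \<open>z j\<close> can err, so the values form the pattern of row
                  \<open>j\<close>.\<close>
                have "zz (K - {l}) x = (if j \<in> K then z j x else s x)" if K: "K \<in> \<Gamma>" "K \<noteq> {l}" for K
                proof -
                  from zz[OF K] obtain j' where j': "j' < l" "K - {l} = {j'}" "zz (K - {l}) = z j'"
                    by blast
                  from j' j(1) have "j \<in> K \<longleftrightarrow> j = j'" by auto
                  moreover have "z j' x = s x" if "j' \<noteq> j"
                    using z(2)[OF j'(1)] x'(1) ne[OF j'(1) that] by auto
                  ultimately show ?thesis using j'(3) by auto
                qed
                with fork_op_pattern[OF T _ _ _ B(1) R' B(3), where z = "\<lambda>K. zz K x" and j = j]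
                show ?thesis using j(1) eq by simp
              next
                case False
                have "zz (K - {l}) x = s x" if K: "K \<in> \<Gamma>" "K \<noteq> {l}" for K
                proof -
                  from zz[OF K] obtain j where j: "j < l" "zz (K - {l}) = z j" by blast
                  have "t j \<noteq> x" using False t j(1) bij_betwE by blast
                  with j z(2)[OF j(1)] x'(1) show ?thesis by auto
                qed
                with fork_op_const[OF T _ B(1) B(3), where z = "\<lambda>K. zz K x"]
                show ?thesis using eq by simp
              qed
            qed
            with xX show ?thesis by (simp add: q_def)
          qed
          ultimately show ?thesis by blast
        qed
      qed
      from this[OF order_refl] obtain q where q: "q \<in> R" "\<And>x. x \<in> X \<Longrightarrow> rk x < m \<or> x = i \<Longrightarrow> q x = s x"
        by blast
      have "rk x < m \<or> x = i" if "x \<in> X" "rk x < Suc m" for x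
        using that i X(2) by (auto simp: less_Suc_eq dest: inj_onD)
      with q show ?thesis by blast
    qed
  qed
  \<comment> \<open>This bound exceeds all ranks, so the agreement is on all of
    \<open>X\<close>.\<close>
  from this[of "Suc (Max (rk ` X))"] obtain r where r: "r \<in> R" "\<And>x. x \<in> X \<Longrightarrow> r x = s x"
    using X(1) by (auto simp: less_Suc_eq_le)
  have "r = s"
    by (rule PiE_ext[OF subsetD[OF S subsetD[OF R r(1)]] subsetD[OF S s] r(2)])
  with r(1) show "s \<in> R" by simp
qed

subsection \<open>Clonoids\<close>

lemma finite_tuples: "finite A \<Longrightarrow> finite (tuples A n)"
  using finite_lists_length_eq[of A n] by (simp add: tuples_def conj_commute)

lemma map_nth_in_tuples:
  "\<sigma> \<in> {..<k} \<rightarrow> {..<l} \<Longrightarrow> xs \<in> tuples A l \<Longrightarrow> map (\<lambda>i. xs ! \<sigma> i) [0..<k] \<in> tuples A k"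
  unfolding tuples_def by (auto simp: Pi_iff subset_iff)

lemma minor_in_fin_funs:
  assumes "(k, f) \<in> fin_funs A B" "\<sigma> \<in> {..<k} \<rightarrow> {..<l}" "1 \<le> l"
  shows "(l, minor A k l \<sigma> f) \<in> fin_funs A B"
  using assms map_nth_in_tuples[OF assms(2)] unfolding fin_funs_def minor_def by auto

lemma minor_minor:
  assumes "\<sigma> \<in> {..<k} \<rightarrow> {..<l}" "\<rho> \<in> {..<l} \<rightarrow> {..<m}"
  shows "minor A l m \<rho> (minor A k l \<sigma> f) = minor A k m (\<lambda>i. \<rho> (\<sigma> i)) f"
  unfolding minor_def
proof (rule restrict_ext)
  fix xs assume "xs \<in> tuples A m"
  then have "map (\<lambda>i. xs ! \<rho> i) [0..<l] \<in> tuples A l" using map_nth_in_tuples assms(2) by blast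
  moreover have "map (\<lambda>i. map (\<lambda>i. xs ! \<rho> i) [0..<l] ! \<sigma> i) [0..<k] = map (\<lambda>i. xs ! \<rho> (\<sigma> i)) [0..<k]"
    using assms(1) by (simp add: Pi_iff)
  ultimately show "(\<lambda>xs\<in>tuples A l. f (map (\<lambda>i. xs ! \<sigma> i) [0..<k])) (map (\<lambda>i. xs ! \<rho> i) [0..<l]) =
      f (map (\<lambda>i. xs ! \<rho> (\<sigma> i)) [0..<k])" by (simp only: restrict_apply')
qed

lemma clonoidD:
  assumes "is_clonoid A B F C"
  shows clonoid_fin_funs: "C \<subseteq> fin_funs A B"
    and clonoid_minor: "\<And>k f l \<sigma>. (k, f) \<in> C \<Longrightarrow> 1 \<le> l \<Longrightarrow> \<sigma> \<in> {..<k} \<rightarrow> {..<l} \<Longrightarrow> (l, minor A k l \<sigma> f) \<in> C"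
    and clonoid_basic: "\<And>k n f gs. 1 \<le> k \<Longrightarrow> (n, f) \<in> F \<Longrightarrow> length gs = n \<Longrightarrow> \<forall>g\<in>set gs. (k, g) \<in> C
      \<Longrightarrow> (k, compose_on A k f gs) \<in> C"
  using assms unfolding is_clonoid_def by blast+

lemma clonoid_value_in:
  assumes "is_clonoid A B F C" "(k, g) \<in> C" "x \<in> tuples A k"
  shows "g x \<in> B"
proof -
  have "(k, g) \<in> fin_funs A B" using clonoid_fin_funs[OF assms(1)] assms(2) by blast
  with assms(3) show ?thesis by (auto simp: fin_funs_def)
qed

lemma term_op_in:
  assumes "is_algebra B F" and "(n, f) \<in> term_ops B F" and "xs \<in> tuples B n"
  shows "f xs \<in> B"
  using assms(2,3)
proof (induction arbitrary: xs rule: term_ops.induct)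
  case (proj i k)
  then show ?case by (auto simp: tuples_def)
next
  case (basic n f)
  with assms(1) show ?case unfolding is_algebra_def by auto
next
  case (comp n f gs k)
  have "map (\<lambda>g. g xs) gs \<in> tuples B n"
    using comp.IH(2) comp.prems comp.hyps by (auto simp: tuples_def)
  with comp show ?case by (simp add: compose_on_def)
qed

lemma clonoid_term_op:
  assumes C: "is_clonoid A B F C" and k: "1 \<le> k"
    and "(n, f) \<in> term_ops B F" and "length gs = n" and "\<forall>g\<in>set gs. (k, g) \<in> C"
  shows "(k, compose_on A k f gs) \<in> C"
  using assms(3-)
proof (induction arbitrary: gs rule: term_ops.induct)
  case (proj i n)
  then have C': "(k, gs ! i) \<in> C" by simp
  have E: "gs ! i \<in> tuples A k \<rightarrow>\<^sub>E B"
    using C' clonoid_fin_funs[OF C] by (auto simp: fin_funs_def)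
  have "compose_on A k (\<lambda>xs\<in>tuples B n. xs ! i) gs = restrict (gs ! i) (tuples A k)"
    unfolding compose_on_def
  proof (rule restrict_ext)
    fix x assume x: "x \<in> tuples A k"
    have "g x \<in> B" if "g \<in> set gs" for g
      using clonoid_value_in[OF C _ x] proj.prems(2) that by blast
    then have "map (\<lambda>g. g x) gs \<in> tuples B n"
      using proj.prems(1) by (simp add: tuples_def image_subset_iff)
    then show "(\<lambda>xs\<in>tuples B n. xs ! i) (map (\<lambda>g. g x) gs) = (gs ! i) x"
      using proj.hyps proj.prems(1) by simp
  qed
  also have "\<dots> = gs ! i" by (rule PiE_restrict[OF E])
  finally have "compose_on A k (\<lambda>xs\<in>tuples B n. xs ! i) gs = gs ! i" .
  with C' show ?case by (simp only:)
next
  case (basic n f)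
  show ?case by (rule clonoid_basic[OF C k basic])
next
  case (comp n f hs m)
  have hs: "(k, compose_on A k h gs) \<in> C" if "h \<in> set hs" for h
    using bspec[OF comp.IH(2) that] comp.prems by simp
  have "map (\<lambda>g. g x) gs \<in> tuples B m" if "x \<in> tuples A k" for x
  proof -
    have "g x \<in> B" if "g \<in> set gs" for g
      using clonoid_value_in[OF C _ \<open>x \<in> tuples A k\<close>] comp.prems(2) that by blast
    then show ?thesis using comp.prems(1) by (simp add: tuples_def image_subset_iff)
  qed
  then have "compose_on A k (compose_on B m f hs) gs = compose_on A k f (map (\<lambda>h. compose_on A k h gs) hs)"
    unfolding compose_on_def by (intro restrict_ext) (simp add: comp_def)
  moreover have "(k, compose_on A k f (map (\<lambda>h. compose_on A k h gs) hs)) \<in> C"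
    by (rule comp.IH(1)) (use hs comp.hyps in auto)
  ultimately show ?case by simp
qed

definition level :: "('a, 'b) fin_fun set \<Rightarrow> nat \<Rightarrow> ('a list \<Rightarrow> 'b) set" where
  "level C n = {f. (n, f) \<in> C}"

lemma length_cube_columns:
  fixes cols :: "bool list list"
  assumes "distinct cols" "set cols = {v. length v = k} - {replicate k False}"
  shows "length cols = 2 ^ k - 1"
proof -
  have "card {v :: bool list. length v = k} = 2 ^ k"
    using card_lists_length_eq[of "UNIV :: bool set" k] by simp
  moreover have "replicate k False \<in> {v. length v = k}" by simp
  ultimately have "card (set cols) = 2 ^ k - 1"
    unfolding assms(2) by (simp add: card_Diff_singleton)
  with assms(1) show ?thesis by (simp add: distinct_card)
qed

text \<open>A Boolean column becomes the set of its true positions; the excluded column of x's is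
  the empty set. Closure of the level under \<open>T\<close> is closure of the clonoid under term
  operations.\<close>

lemma cube_term_label_op:
  assumes C: "is_clonoid A B F C" and alg: "is_algebra B F" and n: "1 \<le> n"
    and c: "is_cube_term B F k c"
  shows "\<exists>T. label_op k B (tuples A n) (level C n) {K. K \<noteq> {} \<and> K \<subseteq> {..<k}} T"
proof -
  from c obtain cols :: "bool list list" where cols: "distinct cols"
    "set cols = {v. length v = k} - {replicate k False}"
    and id: "\<forall>x\<in>B. \<forall>y\<in>B. \<forall>i<k. c (map (\<lambda>v. if v ! i then y else x) cols) = x"
    and c: "(2 ^ k - 1, c) \<in> term_ops B F"
    unfolding is_cube_term_def by blast
  note len = length_cube_columns[OF cols]
  define K where "K v = {i. i < k \<and> v ! i}" for v :: "bool list"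
  have K: "K v \<in> {K. K \<noteq> {} \<and> K \<subseteq> {..<k}}" if "v \<in> set cols" for v
  proof -
    have "length v = k" "v \<noteq> replicate k False" using that cols(2) by auto
    then have "\<exists>i<k. v ! i" by (metis length_replicate nth_equalityI nth_replicate)
    then show ?thesis unfolding K_def by auto
  qed
  define T where "T g = c (map (\<lambda>v. g (K v)) cols)" for g :: "nat set \<Rightarrow> 'b"
  have "T g \<in> B" if g: "\<forall>L\<in>{K. K \<noteq> {} \<and> K \<subseteq> {..<k}}. g L \<in> B" for g
  proof -
    have "g (K v) \<in> B" if "v \<in> set cols" for v by (rule bspec[OF g K[OF that]])
    then have "map (\<lambda>v. g (K v)) cols \<in> tuples B (2 ^ k - 1)" by (simp add: tuples_def len image_subset_iff)
    then show ?thesis unfolding T_def by (rule term_op_in[OF alg c])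
  qed
  moreover have "T g = T g'" if g: "\<forall>L\<in>{K. K \<noteq> {} \<and> K \<subseteq> {..<k}}. g L = g' L" for g g'
  proof -
    have "map (\<lambda>v. g (K v)) cols = map (\<lambda>v. g' (K v)) cols"
      by (rule map_cong[OF refl]) (rule bspec[OF g K])
    then show ?thesis unfolding T_def by (rule arg_cong)
  qed
  moreover have "T (\<lambda>L. if i \<in> L then y else x) = x" if "i < k" "x \<in> B" "y \<in> B" for i x y
    using id that by (simp add: T_def K_def)
  moreover have "(\<lambda>x\<in>tuples A n. T (\<lambda>L. G L x)) \<in> level C n"
    if G: "\<forall>L\<in>{K. K \<noteq> {} \<and> K \<subseteq> {..<k}}. G L \<in> level C n" for G
  proof -
    have "G (K v) \<in> level C n" if "v \<in> set cols" for v by (rule bspec[OF G K[OF that]])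
    then have "(n, compose_on A n c (map (\<lambda>v. G (K v)) cols)) \<in> C"
      by (intro clonoid_term_op[OF C n c]) (simp_all add: len level_def)
    then show ?thesis by (simp add: level_def T_def compose_on_def comp_def)
  qed
  ultimately show ?thesis unfolding label_op_def by (intro exI[of _ T] conjI allI impI ballI)
qed

section \<open>The lexicographic order on tuples and forks along it\<close>

definition lex_less :: "('a \<Rightarrow> nat) \<Rightarrow> 'a list \<Rightarrow> 'a list \<Rightarrow> bool" where
  "lex_less c z a \<longleftrightarrow> (\<exists>p<length a. (\<forall>q<p. z ! q = a ! q) \<and> c (z ! p) < c (a ! p))"

lemma lex_less_irrefl: "\<not> lex_less c a a"
  by (simp add: lex_less_def)

lemma lex_less_trans:
  assumes "lex_less c x y" "lex_less c y z" "length y = length z"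
  shows "lex_less c x z"
proof -
  obtain p q where p: "p < length y" "\<forall>i<p. x ! i = y ! i" "c (x ! p) < c (y ! p)"
    and q: "q < length z" "\<forall>i<q. y ! i = z ! i" "c (y ! q) < c (z ! q)"
    using assms(1,2) unfolding lex_less_def by blast
  consider "p < q" | "p = q" | "q < p" by linarith
  then show ?thesis
  proof cases
    case 1
    with p q assms(3) show ?thesis unfolding lex_less_def by (intro exI[of _ p]) auto
  next
    case 2
    with p q assms(3) show ?thesis unfolding lex_less_def by (intro exI[of _ p]) auto
  next
    case 3
    with p q assms(3) show ?thesis unfolding lex_less_def by (intro exI[of _ q]) auto
  qed
qed

lemma lex_less_total:
  assumes "inj_on c A" "x \<in> tuples A n" "y \<in> tuples A n" "x \<noteq> y"
  shows "lex_less c x y \<or> lex_less c y x"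
proof -
  have len: "length x = n" "length y = n" using assms by (auto simp: tuples_def)
  define p where "p = (LEAST p. p < n \<and> x ! p \<noteq> y ! p)"
  have ex: "\<exists>p. p < n \<and> x ! p \<noteq> y ! p" using assms(4) len by (metis nth_equalityI)
  have p: "p < n" "x ! p \<noteq> y ! p" using LeastI_ex[OF ex] unfolding p_def by auto
  have q: "x ! q = y ! q" if "q < p" for q
    using not_less_Least[OF that[unfolded p_def]] that p(1) by auto
  have "x ! p \<in> A" "y ! p \<in> A" using assms(2,3) p(1) len by (auto simp: tuples_def subset_iff)
  then have "c (x ! p) \<noteq> c (y ! p)" using assms(1) p(2) by (meson inj_onD)
  then have "c (x ! p) < c (y ! p) \<or> c (y ! p) < c (x ! p)" by linarith
  then show ?thesis
  proof
    assume "c (x ! p) < c (y ! p)"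
    then have "lex_less c x y" unfolding lex_less_def len using p(1) q by blast
    then show ?thesis ..
  next
    assume "c (y ! p) < c (x ! p)"
    then have "lex_less c y x" unfolding lex_less_def len using p(1) q[symmetric] by blast
    then show ?thesis ..
  qed
qed

lemma finite_linear_order_rank:
  assumes "finite X" and irr: "\<And>x. x \<in> X \<Longrightarrow> \<not> lt x x"
    and trans: "\<And>x y z. x \<in> X \<Longrightarrow> y \<in> X \<Longrightarrow> z \<in> X \<Longrightarrow> lt x y \<Longrightarrow> lt y z \<Longrightarrow> lt x z"
    and total: "\<And>x y. x \<in> X \<Longrightarrow> y \<in> X \<Longrightarrow> x \<noteq> y \<Longrightarrow> lt x y \<or> lt y x"
  shows "\<exists>rk :: 'x \<Rightarrow> nat. inj_on rk X \<and> (\<forall>x\<in>X. \<forall>y\<in>X. rk x < rk y \<longleftrightarrow> lt x y)"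
proof -
  define rk where "rk x = card {y \<in> X. lt y x}" for x
  have less: "rk x < rk y" if "x \<in> X" "y \<in> X" "lt x y" for x y
    unfolding rk_def
  proof (rule psubset_card_mono)
    have "{z \<in> X. lt z x} \<subseteq> {z \<in> X. lt z y}" using trans that by blast
    moreover have "x \<in> {z \<in> X. lt z y}" "x \<notin> {z \<in> X. lt z x}" using that irr by auto
    ultimately show "{z \<in> X. lt z x} \<subset> {z \<in> X. lt z y}" by blast
  qed (use assms(1) in simp)
  have iff: "rk x < rk y \<longleftrightarrow> lt x y" if "x \<in> X" "y \<in> X" for x y
  proof
    assume r: "rk x < rk y"
    with less[OF that(2,1)] have "\<not> lt y x" by linarith
    moreover from r have "x \<noteq> y" by auto
    ultimately show "lt x y" using total[OF that] by blast
  qed (rule less[OF that])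
  have "inj_on rk X"
  proof (rule inj_onI, rule ccontr)
    fix x y assume xy: "x \<in> X" "y \<in> X" "rk x = rk y" "x \<noteq> y"
    with total[of x y] iff[of x y] iff[of y x] show False by simp
  qed
  with iff show ?thesis by blast
qed

definition fork_set :: "'a set \<Rightarrow> ('a \<Rightarrow> nat) \<Rightarrow> ('a, 'b) fin_fun set \<Rightarrow> 'a list \<Rightarrow> ('b \<times> 'b) set" where
  "fork_set A c D a = {(f a, g a) |f g. f \<in> level D (length a) \<and> g \<in> level D (length a) \<and>
     (\<forall>z\<in>tuples A (length a). lex_less c z a \<longrightarrow> f z = g z)}"

lemma fork_set_antimono:
  assumes D: "\<And>k l f \<sigma>. (k, f) \<in> D \<Longrightarrow> 1 \<le> l \<Longrightarrow> \<sigma> \<in> {..<k} \<rightarrow> {..<l} \<Longrightarrow> (l, minor A k l \<sigma> f) \<in> D"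
    and emb: "word_emb {} v w" and v: "v \<in> lists A" "v \<noteq> []"
  shows "fork_set A c D w \<subseteq> fork_set A c D v"
proof
  fix e assume "e \<in> fork_set A c D w"
  then obtain f g where e: "e = (f w, g w)" and fg: "(length w, f) \<in> D" "(length w, g) \<in> D"
    and eq: "\<And>z. z \<in> tuples A (length w) \<Longrightarrow> lex_less c z w \<Longrightarrow> f z = g z"
    by (auto simp: fork_set_def level_def)
  obtain \<sigma> where s: "\<And>i. i < length w \<Longrightarrow> \<sigma> i < length v \<and> w ! i = v ! \<sigma> i"
    and first: "\<And>p. p < length v \<Longrightarrow> \<exists>i<length w. \<sigma> i = p \<and> (\<forall>j<i. \<sigma> j < p)"
    using word_emb_minor[OF emb, of "[]"] by auto
  let ?m = "minor A (length w) (length v) \<sigma>"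
  have \<sigma>: "\<sigma> \<in> {..<length w} \<rightarrow> {..<length v}" using s by auto
  have w: "w = map (\<lambda>i. v ! \<sigma> i) [0..<length w]" using s by (intro nth_equalityI) auto
  have vA: "v \<in> tuples A (length v)" using v by (auto simp: tuples_def)
  have at: "?m h v = h w" for h :: "'a list \<Rightarrow> 'b" using vA w by (simp add: minor_def)
  have "?m f z = ?m g z" if z: "z \<in> tuples A (length v)" "lex_less c z v" for z
  proof -
    let ?z = "map (\<lambda>i. z ! \<sigma> i) [0..<length w]"
    obtain p where p: "p < length v" "\<forall>q<p. z ! q = v ! q" "c (z ! p) < c (v ! p)"
      using z(2) unfolding lex_less_def by blast
    \<comment> \<open>The tuple \<open>?z\<close> first leaves \<open>w\<close> at the first index
      \<open>i\<close> mapped to \<open>p\<close>: earlier indices go to positions below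
      \<open>p\<close>, where \<open>z\<close> and \<open>v\<close> agree.\<close>
    obtain i where "i < length w" "\<sigma> i = p" "\<forall>j<i. \<sigma> j < p" using first[OF p(1)] by blast
    with p s have "lex_less c ?z w" unfolding lex_less_def by (intro exI[of _ i]) auto
    with eq map_nth_in_tuples[OF \<sigma> z(1)] z(1) show ?thesis by (simp add: minor_def)
  qed
  moreover have "?m f \<in> level D (length v)" "?m g \<in> level D (length v)"
    using D fg \<sigma> v(2) by (auto simp: level_def Suc_le_eq)
  ultimately show "e \<in> fork_set A c D v"
    unfolding fork_set_def e using at[of f] at[of g] by (intro CollectI exI[of _ "?m f"] exI[of _ "?m g"]) simp
qed

subsection \<open>Functions determined by their minors of bounded arity\<close>

definition minors_in :: "'a set \<Rightarrow> 'b set \<Rightarrow> ('a, 'b) fin_fun set \<Rightarrow> nat \<Rightarrow> ('a, 'b) fin_fun set" where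
  "minors_in A B C m = {(n, f) \<in> fin_funs A B. \<forall>\<sigma>\<in>{..<n} \<rightarrow> {..<m}. (m, minor A n m \<sigma> f) \<in> C}"

lemma minors_in_minor:
  assumes "(k, f) \<in> minors_in A B C m" "1 \<le> l" "\<sigma> \<in> {..<k} \<rightarrow> {..<l}"
  shows "(l, minor A k l \<sigma> f) \<in> minors_in A B C m"
proof -
  have "(m, minor A l m \<rho> (minor A k l \<sigma> f)) \<in> C" if "\<rho> \<in> {..<l} \<rightarrow> {..<m}" for \<rho>
  proof -
    have "(\<lambda>i. \<rho> (\<sigma> i)) \<in> {..<k} \<rightarrow> {..<m}" using assms(3) that by (simp add: Pi_iff)
    with assms(1) show ?thesis unfolding minor_minor[OF assms(3) that] by (simp add: minors_in_def)
  qed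
  moreover have "(l, minor A k l \<sigma> f) \<in> fin_funs A B"
    by (rule minor_in_fin_funs[OF _ assms(3,2)]) (use assms(1) in \<open>simp add: minors_in_def\<close>)
  ultimately show ?thesis by (simp add: minors_in_def)
qed

lemma clonoid_subset_minors_in:
  assumes "is_clonoid A B F C" "1 \<le> m"
  shows "C \<subseteq> minors_in A B C m"
proof
  fix h assume h: "h \<in> C"
  obtain n f where [simp]: "h = (n, f)" by (cases h)
  show "h \<in> minors_in A B C m"
    using h clonoid_fin_funs[OF assms(1)] clonoid_minor[OF assms(1) _ assms(2)]
    by (auto simp: minors_in_def)
qed

text \<open>A substitution of variables that factors through \<open>m\<close> variables yields a
  member of \<open>C\<close>, since the intermediate minor is one of the tested \<open>m\<close>-ary
  ones.\<close>

lemma minor_fixing: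
  assumes "is_clonoid A B F C" and f: "(n, f) \<in> minors_in A B C m"
    and \<sigma>: "\<sigma> \<in> {..<n} \<rightarrow> {..<m}" and \<rho>: "\<rho> \<in> {..<m} \<rightarrow> {..<n}"
  shows "minor A n n (\<lambda>i. \<rho> (\<sigma> i)) f \<in> level C n"
proof -
  have "1 \<le> n" using f by (simp add: minors_in_def fin_funs_def)
  moreover have "(m, minor A n m \<sigma> f) \<in> C" using f \<sigma> by (simp add: minors_in_def)
  ultimately have "(n, minor A m n \<rho> (minor A n m \<sigma> f)) \<in> C"
    using clonoid_minor[OF assms(1)] \<rho> by blast
  then show ?thesis unfolding minor_minor[OF \<sigma> \<rho>] by (simp add: level_def)
qed

lemma level_minors_in_low:
  assumes C: "is_clonoid A B F C" and "1 \<le> n" "n \<le> m"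
  shows "level (minors_in A B C m) n \<subseteq> level C n"
proof
  fix f assume "f \<in> level (minors_in A B C m) n"
  then have f: "(n, f) \<in> minors_in A B C m" by (simp add: level_def)
  \<comment> \<open>The variables from \<open>n\<close> to \<open>m - 1\<close> are dummies; sending
    them to 0 is legitimate because \<open>1 \<le> n\<close>.\<close>
  define \<rho> where "\<rho> i = (if i < n then i else 0)" for i
  have "minor A n n (\<lambda>i. \<rho> (id i)) f \<in> level C n"
    by (rule minor_fixing[OF C f]) (use assms in \<open>auto simp: \<rho>_def\<close>)
  moreover have "minor A n n (\<lambda>i. \<rho> (id i)) f = restrict f (tuples A n)"
    unfolding minor_def
  proof (rule restrict_ext)
    fix xs assume "xs \<in> tuples A n"
    then have "map (\<lambda>i. xs ! \<rho> (id i)) [0..<n] = xs"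
      by (intro nth_equalityI) (auto simp: \<rho>_def tuples_def)
    then show "f (map (\<lambda>i. xs ! \<rho> (id i)) [0..<n]) = f xs" by (simp only:)
  qed
  moreover have "restrict f (tuples A n) = f"
    using f by (intro PiE_restrict) (auto simp: minors_in_def fin_funs_def)
  ultimately show "f \<in> level C n" by simp
qed

text \<open>Identifying the variables that have equal columns in \<open>Y\<close> does not change the values on \<open>Y\<close>.\<close>

lemma minors_in_projection:
  assumes C: "is_clonoid A B F C" and "finite A"
    and s: "s \<in> level (minors_in A B C m) n" and Y: "Y \<subseteq> tuples A n" "card Y \<le> K"
    and m: "Suc (card A) ^ K \<le> m"
  shows "\<exists>r\<in>level C n. \<forall>x\<in>Y. r x = s x"
proof -
  have fY: "finite Y" using finite_subset[OF Y(1) finite_tuples[OF assms(2)]] .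
  have s': "(n, s) \<in> minors_in A B C m" using s by (simp add: level_def)
  then have n: "1 \<le> n" by (simp add: minors_in_def fin_funs_def)
  define col where "col i = (\<lambda>y\<in>Y. y ! i)" for i
  have "col ` {..<n} \<subseteq> Y \<rightarrow>\<^sub>E A"
    using Y(1) by (auto simp: col_def tuples_def subset_iff)
  then have "card (col ` {..<n}) \<le> card (Y \<rightarrow>\<^sub>E A)"
    using fY assms(2) by (intro card_mono finite_PiE)
  also have "\<dots> = card A ^ card Y" using fY by (simp add: card_PiE)
  \<comment> \<open>With base \<open>Suc (card A)\<close> the power is monotone in the exponent even
    for empty \<open>A\<close>.\<close>
  also have "\<dots> \<le> Suc (card A) ^ card Y" by (simp add: power_mono)
  also have "\<dots> \<le> Suc (card A) ^ K" using Y(2) by (intro power_increasing) auto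
  finally have "card (col ` {..<n}) \<le> card {..<m}" using m by simp
  then obtain h where h: "h ` col ` {..<n} \<subseteq> {..<m}" "inj_on h (col ` {..<n})"
    using inj_on_iff_card_le[of "col ` {..<n}" "{..<m}"] by auto
  define \<sigma> where "\<sigma> i = h (col i)" for i
  define \<rho> where "\<rho> j = (if \<exists>i<n. \<sigma> i = j then SOME i. i < n \<and> \<sigma> i = j else 0)" for j
  have \<rho>: "\<rho> (\<sigma> i) < n \<and> \<sigma> (\<rho> (\<sigma> i)) = \<sigma> i" if "i < n" for i
  proof -
    have "\<rho> (\<sigma> i) = (SOME i'. i' < n \<and> \<sigma> i' = \<sigma> i)" using that by (auto simp: \<rho>_def)
    then show ?thesis using someI[of "\<lambda>i'. i' < n \<and> \<sigma> i' = \<sigma> i" i] that by simp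
  qed
  have \<rho>n: "\<rho> j < n" for j
  proof (cases "\<exists>i<n. \<sigma> i = j")
    case True
    with \<rho> show ?thesis by blast
  next
    case False
    then have "\<rho> j = 0" unfolding \<rho>_def by (rule if_not_P)
    with n show ?thesis by simp
  qed
  have "minor A n n (\<lambda>i. \<rho> (\<sigma> i)) s \<in> level C n"
    by (rule minor_fixing[OF C s']) (use h(1) \<rho>n in \<open>auto simp: \<sigma>_def\<close>)
  moreover have "minor A n n (\<lambda>i. \<rho> (\<sigma> i)) s x = s x" if x: "x \<in> Y" for x
  proof -
    have "x ! \<rho> (\<sigma> i) = x ! i" if i: "i < n" for i
    proof -
      have "col (\<rho> (\<sigma> i)) = col i"
        using \<rho>[OF i] h(2) i unfolding \<sigma>_def inj_on_def by blast
      then have "col (\<rho> (\<sigma> i)) x = col i x" by simp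
      with x show ?thesis by (simp add: col_def)
    qed
    moreover have "length x = n" using x Y(1) by (auto simp: tuples_def)
    ultimately have "map (\<lambda>i. x ! \<rho> (\<sigma> i)) [0..<n] = x" by (intro nth_equalityI) auto
    with x Y(1) show ?thesis by (auto simp: minor_def)
  qed
  ultimately show ?thesis by blast
qed

lemma ex_uniform_bound:
  assumes "finite I" and "\<And>i. i \<in> I \<Longrightarrow> \<exists>m :: nat. Q i m" and "\<And>i m m'. Q i m \<Longrightarrow> m \<le> m' \<Longrightarrow> Q i m'"
  shows "\<exists>m. \<forall>i\<in>I. Q i m"
  using assms(1,2)
proof (induction I rule: finite_induct)
  case (insert i I)
  from insert.IH insert.prems obtain m where "\<forall>j\<in>I. Q j m" by blast
  moreover from insert.prems[of i] obtain m' where "Q i m'" by blast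
  ultimately show ?case
    using assms(3)[of _ m "max m m'"] assms(3)[of i m' "max m m'"] by - (rule exI[of _ "max m m'"], simp)
qed simp

text \<open>\<open>P\<close> consists of the \<open>m\<close> projections on
  \<open>tuples A m\<close>, written as tuples along the enumeration \<open>L\<close>, and
  \<open>Q\<close> of the members of \<open>C\<close> of arity \<open>m\<close>. Choosing
  \<open>n\<close> elements of \<open>P\<close> means choosing a map \<open>\<sigma>\<close> from
  \<open>n\<close> to \<open>m\<close> variables, and \<open>f\<close> applied to them is its minor
  along \<open>\<sigma>\<close>. For empty \<open>A\<close> the list \<open>L\<close> is empty and
  the pair has arity 0.\<close>

lemma minors_in_eq_Pol:
  assumes A: "finite A" and C: "is_clonoid A B F C" and m: "1 \<le> m"
  obtains r where "is_rel_pair A B r" "minors_in A B C m = Pol A B {r}"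
proof -
  obtain L where L: "set L = tuples A m" using finite_list[OF finite_tuples[OF A]] by blast
  define p where "p i = map (\<lambda>x. x ! i) L" for i
  define P where "P = p ` {..<m}"
  define Q where "Q = (\<lambda>g. map g L) ` level C m"
  have "is_rel_pair A B (length L, P, Q)"
  proof -
    have "x ! i \<in> A" if "i < m" "x \<in> tuples A m" for i x
      using that by (auto simp: tuples_def subset_iff)
    then have "P \<subseteq> tuples A (length L)" using L by (auto simp: P_def p_def tuples_def)
    moreover have "map g L \<in> tuples B (length L)" if "g \<in> level C m" for g
      using clonoid_value_in[OF C] that L by (auto simp: level_def tuples_def)
    ultimately show ?thesis by (auto simp: is_rel_pair_def Q_def)
  qed
  moreover have "is_polymorphism (n, f) (length L, P, Q) \<longleftrightarrow>
      (\<forall>\<sigma>\<in>{..<n} \<rightarrow> {..<m}. (m, minor A n m \<sigma> f) \<in> C)" for n f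
  proof -
    have val: "map (\<lambda>j. f (map (\<lambda>q. q ! j) (map (\<lambda>i. p (\<sigma> i)) [0..<n]))) [0..<length L] = map (minor A n m \<sigma> f) L" for \<sigma>
    proof (rule nth_equalityI)
      fix j assume "j < length (map (\<lambda>j. f (map (\<lambda>q. q ! j) (map (\<lambda>i. p (\<sigma> i)) [0..<n]))) [0..<length L])"
      then have j: "j < length L" by simp
      then have "L ! j \<in> tuples A m" using L nth_mem by blast
      moreover have "map (\<lambda>q. q ! j) (map (\<lambda>i. p (\<sigma> i)) [0..<n]) = map (\<lambda>i. L ! j ! \<sigma> i) [0..<n]"
        using j by (auto simp: p_def)
      ultimately show "map (\<lambda>j. f (map (\<lambda>q. q ! j) (map (\<lambda>i. p (\<sigma> i)) [0..<n]))) [0..<length L] ! j = map (minor A n m \<sigma> f) L ! j"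
        using j by (simp add: minor_def del: map_map map_eq_conv)
    qed simp
    have rel: "map (minor A n m \<sigma> f) L \<in> Q \<longleftrightarrow> (m, minor A n m \<sigma> f) \<in> C" for \<sigma>
    proof
      assume "map (minor A n m \<sigma> f) L \<in> Q"
      then obtain g where g: "(m, g) \<in> C" "map (minor A n m \<sigma> f) L = map g L"
        by (auto simp: Q_def level_def)
      then have eq: "minor A n m \<sigma> f x = g x" if "x \<in> tuples A m" for x
        using that L by auto
      have "g \<in> tuples A m \<rightarrow>\<^sub>E B" using g(1) clonoid_fin_funs[OF C] by (auto simp: fin_funs_def)
      then have "g = restrict g (tuples A m)" by (rule PiE_restrict[symmetric])
      also have "\<dots> = restrict (minor A n m \<sigma> f) (tuples A m)" using eq by (intro restrict_ext) simp
      also have "\<dots> = minor A n m \<sigma> f" by (simp add: minor_def)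
      finally show "(m, minor A n m \<sigma> f) \<in> C" using g(1) by simp
    qed (auto simp: Q_def level_def)
    have "tuples P n = (\<lambda>\<sigma>. map (\<lambda>i. p (\<sigma> i)) [0..<n]) ` ({..<n} \<rightarrow> {..<m})"
    proof
      show "tuples P n \<subseteq> (\<lambda>\<sigma>. map (\<lambda>i. p (\<sigma> i)) [0..<n]) ` ({..<n} \<rightarrow> {..<m})"
      proof
        fix ps assume ps: "ps \<in> tuples P n"
        then have "\<forall>i. \<exists>j. i < n \<longrightarrow> j < m \<and> ps ! i = p j"
          by (auto simp: tuples_def P_def subset_iff image_iff in_set_conv_nth)
        then obtain \<sigma> where \<sigma>: "\<forall>i. i < n \<longrightarrow> \<sigma> i < m \<and> ps ! i = p (\<sigma> i)" by (rule choice[THEN exE])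
        then have "ps = map (\<lambda>i. p (\<sigma> i)) [0..<n]"
          using ps by (intro nth_equalityI) (auto simp: tuples_def)
        with \<sigma> show "ps \<in> (\<lambda>\<sigma>. map (\<lambda>i. p (\<sigma> i)) [0..<n]) ` ({..<n} \<rightarrow> {..<m})" by auto
      qed
    qed (auto simp: tuples_def P_def Pi_iff)
    then show ?thesis by (simp add: is_polymorphism_def val rel del: map_map)
  qed
  then have "minors_in A B C m = Pol A B {(length L, P, Q)}"
    by (auto simp: minors_in_def Pol_def)
  ultimately show thesis using that by blast
qed

lemma countable_rel_pairs:
  assumes "finite A" "finite B"
  shows "countable {r. is_rel_pair A B r}"
proof -
  have "{r. is_rel_pair A B r} = (\<Union>m. {m} \<times> Pow (tuples A m) \<times> Pow (tuples B m))"
    by (auto simp: is_rel_pair_def)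
  moreover have "countable (\<Union>m. {m} \<times> Pow (tuples A m) \<times> Pow (tuples B m))"
    using assms by (intro countable_UN) (auto intro!: countable_finite simp: finite_tuples)
  ultimately show ?thesis by simp
qed

section \<open>Comparison of a clonoid with the functions whose minors of bounded arity lie in
  it\<close>

lemma lex_rank:
  assumes A: "finite A" and c: "inj_on c A"
  obtains rk :: "'a list \<Rightarrow> nat" where "inj_on rk (tuples A n)"
    "\<And>x y. x \<in> tuples A n \<Longrightarrow> y \<in> tuples A n \<Longrightarrow> rk x < rk y \<longleftrightarrow> lex_less c x y"
proof -
  have "\<exists>rk :: 'a list \<Rightarrow> nat. inj_on rk (tuples A n) \<and>
      (\<forall>x\<in>tuples A n. \<forall>y\<in>tuples A n. rk x < rk y \<longleftrightarrow> lex_less c x y)"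
  proof (rule finite_linear_order_rank[OF finite_tuples[OF A] lex_less_irrefl])
    fix x y z :: "'a list"
    show "lex_less c x z" if "y \<in> tuples A n" "z \<in> tuples A n" "lex_less c x y" "lex_less c y z"
      using lex_less_trans[OF that(3,4)] that(1,2) by (simp add: tuples_def)
    show "lex_less c x y \<or> lex_less c y x" if "x \<in> tuples A n" "y \<in> tuples A n" "x \<noteq> y"
      by (rule lex_less_total[OF c that])
  qed
  then show thesis using that by blast
qed

lemma clonoid_level_eqI:
  assumes A: "finite A" and alg: "is_algebra B F" and t: "is_cube_term B F k t"
    and C: "is_clonoid A B F C" and c: "inj_on c A" and n: "1 \<le> n"
    and CD: "level C n \<subseteq> level D n" and D: "level D n \<subseteq> tuples A n \<rightarrow>\<^sub>E B"
    and proj: "\<And>s Y. s \<in> level D n \<Longrightarrow> Y \<subseteq> tuples A n \<Longrightarrow> card Y \<le> k \<Longrightarrow> \<exists>r\<in>level C n. \<forall>x\<in>Y. r x = s x"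
    and forks: "\<And>a. a \<in> tuples A n \<Longrightarrow> fork_set A c D a \<subseteq> fork_set A c C a"
  shows "level C n = level D n"
proof -
  from t obtain l where l: "k = Suc l" unfolding is_cube_term_def by (cases k) auto
  obtain T where "label_op k B (tuples A n) (level C n) {K. K \<noteq> {} \<and> K \<subseteq> {..<k}} T"
    using cube_term_label_op[OF C alg n t] by blast
  from edge_like_label_op[OF this _ _ l]
  obtain \<Gamma> T' where T': "label_op (Suc l) B (tuples A n) (level C n) \<Gamma> T'"
    and \<Gamma>: "\<And>K. K \<in> \<Gamma> \<Longrightarrow> K \<noteq> {l} \<Longrightarrow> \<exists>j<l. K - {l} = {j}"
    unfolding l by blast
  obtain rk :: "'a list \<Rightarrow> nat" where rk: "inj_on rk (tuples A n)"
    "\<And>x y. x \<in> tuples A n \<Longrightarrow> y \<in> tuples A n \<Longrightarrow> rk x < rk y \<longleftrightarrow> lex_less c x y"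
    by (rule lex_rank[OF A c, of n], rule that) simp_all
  show ?thesis
  proof (rule subpower_eq_if_forks[OF T' \<Gamma> finite_tuples[OF A] rk(1) CD D])
    show "\<exists>r\<in>level C n. \<forall>x\<in>Y. r x = s x"
      if "s \<in> level D n" "Y \<subseteq> tuples A n" "card Y \<le> Suc l" for s Y
      by (rule proj[OF that(1,2)]) (simp add: that(3) l)
    show "\<exists>u\<in>level C n. \<exists>v\<in>level C n. (\<forall>x\<in>tuples A n. rk x < rk a \<longrightarrow> u x = v x) \<and> u a = r a \<and> v a = s a"
      if a: "a \<in> tuples A n" and r: "r \<in> level D n" and s: "s \<in> level D n"
        and eq: "\<forall>x\<in>tuples A n. rk x < rk a \<longrightarrow> r x = s x" for a r s
    proof -
      have len: "length a = n" using a by (simp add: tuples_def)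
      have "\<forall>x\<in>tuples A n. lex_less c x a \<longrightarrow> r x = s x" using eq rk(2)[OF _ a] by simp
      with r s have "(r a, s a) \<in> fork_set A c D a" unfolding fork_set_def len by blast
      with forks[OF a] have "(r a, s a) \<in> fork_set A c C a" ..
      then obtain u v where uv: "u \<in> level C n" "v \<in> level C n" "r a = u a" "s a = v a"
        "\<forall>z\<in>tuples A n. lex_less c z a \<longrightarrow> u z = v z"
        unfolding fork_set_def len by auto
      then have "\<forall>x\<in>tuples A n. rk x < rk a \<longrightarrow> u x = v x" using rk(2)[OF _ a] by simp
      with uv show ?thesis by auto
    qed
  qed
qed

text \<open>\<open>U p\<close> collects the nonempty words at which \<open>p\<close> is not a fork
  of \<open>C\<close>. If \<open>?D\<close> had such a \<open>p\<close> as a fork at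
  \<open>a\<close>, a short \<open>v\<close> in \<open>U p\<close> would embed into
  \<open>a\<close>, and \<open>p\<close> would be a fork of \<open>?D\<close> at \<open>v\<close>.
  At arities up to \<open>m\<close> there is nothing in \<open>?D\<close> beyond \<open>C\<close>, a
  contradiction.\<close>

theorem clonoid_eq_minors_in:
  assumes A: "finite A" and B: "finite B" and alg: "is_algebra B F" and cube: "has_cube_term B F"
    and C: "is_clonoid A B F C"
  shows "\<exists>m\<ge>1. C = minors_in A B C m"
proof -
  obtain k t where t: "is_cube_term B F k t" using cube unfolding has_cube_term_def by blast
  obtain c :: "'a \<Rightarrow> nat" where c: "inj_on c A"
    using finite_imp_inj_to_nat_seg[OF A] by blast
  define U where "U p = {a \<in> lists A. a \<noteq> [] \<and> p \<notin> fork_set A c C a}" for p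
  have "\<exists>m. \<forall>p\<in>B \<times> B. \<forall>w\<in>U p. \<exists>v\<in>U p. word_emb {} v w \<and> length v \<le> m"
  proof (rule ex_uniform_bound)
    show "\<exists>m. \<forall>w\<in>U p. \<exists>v\<in>U p. word_emb {} v w \<and> length v \<le> m" for p
      by (rule wqo_on_finite_basis[OF wqo_on_word_emb[OF A]]) (auto simp: U_def)
    show "finite (B \<times> B)" using B by simp
    show "\<forall>w\<in>U p. \<exists>v\<in>U p. word_emb {} v w \<and> length v \<le> m'"
      if "\<forall>w\<in>U p. \<exists>v\<in>U p. word_emb {} v w \<and> length v \<le> m" "m \<le> m'" for p m m'
      using that by (meson order_trans)
  qed
  then obtain m0 where m0: "\<And>p w. p \<in> B \<times> B \<Longrightarrow> w \<in> U p \<Longrightarrow> \<exists>v\<in>U p. word_emb {} v w \<and> length v \<le> m0"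
    by blast
  \<comment> \<open>\<open>m0\<close> controls the forks; the power controls projections to at most
    \<open>k\<close> coordinates and ensures \<open>1 \<le> m\<close>.\<close>
  define m where "m = max m0 (Suc (card A) ^ k)"
  have m: "m0 \<le> m" "Suc (card A) ^ k \<le> m" by (simp_all add: m_def)
  have "1 \<le> Suc (card A) ^ k" by (rule one_le_power) simp
  with m(2) have m1: "1 \<le> m" by linarith
  let ?D = "minors_in A B C m"
  have CD: "C \<subseteq> ?D" by (rule clonoid_subset_minors_in[OF C m1])
  have DE: "level ?D n \<subseteq> tuples A n \<rightarrow>\<^sub>E B" for n
    by (auto simp: level_def minors_in_def fin_funs_def)
  have forks: "fork_set A c ?D a \<subseteq> fork_set A c C a" if a: "a \<in> lists A" "a \<noteq> []" for a
  proof (rule subsetI, rule ccontr)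
    fix p assume p: "p \<in> fork_set A c ?D a" "p \<notin> fork_set A c C a"
    have "a \<in> tuples A (length a)" using a by (auto simp: tuples_def)
    with p(1) DE have "p \<in> B \<times> B" unfolding fork_set_def by fast
    moreover have "a \<in> U p" using a p(2) by (simp add: U_def)
    ultimately obtain v where v: "v \<in> U p" "word_emb {} v a" "length v \<le> m0"
      using m0 by blast
    from v(1) have vA: "v \<in> lists A" "v \<noteq> []" by (auto simp: U_def)
    have "1 \<le> length v" using vA(2) by (simp add: Suc_le_eq)
    moreover have "length v \<le> m" using v(3) m(1) by simp
    ultimately have low: "level ?D (length v) \<subseteq> level C (length v)"
      by (rule level_minors_in_low[OF C])
    have "fork_set A c ?D a \<subseteq> fork_set A c ?D v"
      by (rule fork_set_antimono[OF minors_in_minor v(2) vA])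
    with p(1) have "p \<in> fork_set A c ?D v" ..
    with low have "p \<in> fork_set A c C v" unfolding fork_set_def by blast
    with v(1) show False by (simp add: U_def)
  qed
  have eq: "level C n = level ?D n" if n: "1 \<le> n" for n
  proof (rule clonoid_level_eqI[OF A alg t C c n _ DE])
    show "level C n \<subseteq> level ?D n" using CD by (auto simp: level_def)
    show "fork_set A c ?D a \<subseteq> fork_set A c C a" if "a \<in> tuples A n" for a
      by (rule forks) (use that n in \<open>auto simp: tuples_def\<close>)
  qed (rule minors_in_projection[OF C A _ _ _ m(2)])
  have "?D \<subseteq> C"
  proof
    fix h assume h: "h \<in> ?D"
    obtain n f where [simp]: "h = (n, f)" by (cases h)
    have "1 \<le> n" using h by (simp add: minors_in_def fin_funs_def)
    with eq[of n] h show "h \<in> C" by (auto simp: level_def set_eq_iff)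
  qed
  with CD have "C = ?D" by (rule antisym)
  with m1 show ?thesis by blast
qed

theorem theorem3p1:
  fixes A :: "'a set" and B :: "'b set" and F :: "('b, 'b) fin_fun set"
  assumes "finite A" and "finite B" and "is_algebra B F" and "has_cube_term B F"
  shows "(\<forall>C. is_clonoid A B F C \<longrightarrow> finitely_related A B C) \<and>
         countable {C. is_clonoid A B F C}"
proof
  show fr: "\<forall>C. is_clonoid A B F C \<longrightarrow> finitely_related A B C"
  proof (intro allI impI)
    fix C :: "('a, 'b) fin_fun set" assume C: "is_clonoid A B F C"
    obtain m where "1 \<le> m" "C = minors_in A B C m"
      using clonoid_eq_minors_in[OF assms C] by blast
    with minors_in_eq_Pol[OF assms(1) C] obtain r where "is_rel_pair A B r" "C = Pol A B {r}"
      by metis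
    then show "finitely_related A B C"
      unfolding finitely_related_def by (intro exI[of _ "{r}"]) simp
  qed
  \<comment> \<open>Each clonoid is named by a finite subset of the countable set of relation pairs,
    whatever the size of \<open>F\<close>.\<close>
  have "{C. is_clonoid A B F C} \<subseteq> Pol A B ` {R. finite R \<and> R \<subseteq> {r. is_rel_pair A B r}}"
    using fr unfolding finitely_related_def by blast
  moreover have "countable (Pol A B ` {R. finite R \<and> R \<subseteq> {r. is_rel_pair A B r}})"
    by (intro countable_image countable_Collect_finite_subset countable_rel_pairs assms)
  ultimately show "countable {C. is_clonoid A B F C}" by (rule countable_subset)
qed

end
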